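(* There exists an algorithm which, given $\mathsf{COND}$ access to two distributions $\mathcal{P}$ and $\mathcal{Q}$ on $[n]$ and a parameter $\epsilon>0$, makes at most $O\!\left(\frac{\log n\,(\log\log n)\,\log(1/\epsilon)}{\epsilon^{9}}\right)$ queries to the oracle, is one-round adaptive, and decides whether $\mathcal{P}=\mathcal{Q}$ or $d_{TV}(\mathcal{P},\mathcal{Q})\ge\epsilon$ with probability at least $2/3$; that is, if $\mathcal{P}=\mathcal{Q}$ it outputs Accept with probability at least $2/3$, and if $d_{TV}(\mathcal{P},\mathcal{Q})\ge\epsilon$ it outputs Reject with probability at least $2/3$.
   Context: Distributions are over $[n]=\{1,\dots,n\}$; for $S\subseteq[n]$, $\mathcal{D}(S)=\sum_{i\in S}\mathcal{D}(i)$. The total variation distance is $d_{TV}(\mathcal{P},\mathcal{Q})=\frac12\sum_{i\in[n]}|\mathcal{P}(i)-\mathcal{Q}(i)|$. A conditional sampling oracle $\mathsf{COND}_{\mathcal{D}}$ takes as input a set $S\subseteq[n]$ and returns $j\in S$ with probability $\mathcal{D}(j)/\mathcal{D}(S)$ if $\mathcal{D}(S)>0$, and with probability $1/|S|$ if $\mathcal{D}(S)=0$. A one-round adaptive tester operates in two rounds: in the first round, without making any queries, it selects subsets $S^0_1,\dots,S^0_{q_1}$ of $[n]$ and queries $\mathsf{COND}_{\mathcal{P}}(S^0_k)$ and $\mathsf{COND}_{\mathcal{Q}}(S^0_k)$ for all $k$; in the second round, based on the answers from the first round, it selects subsets $S^1_1,\dots,S^1_{q_2}$ and queries $\mathsf{COND}_{\mathcal{P}}(S^1_k)$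 and $\mathsf{COND}_{\mathcal{Q}}(S^1_k)$ for all $k$; its output depends on all $2(q_1+q_2)$ answers, and its query complexity is $2(q_1+q_2)$. *)

theory Defs
  imports "HOL-Probability.Probability"
begin

definition dist_on :: "nat \<Rightarrow> nat pmf \<Rightarrow> bool" where
  "dist_on n D \<longleftrightarrow> set_pmf D \<subseteq> {1..n}"

definition d_TV :: "nat \<Rightarrow> nat pmf \<Rightarrow> nat pmf \<Rightarrow> real" where
  "d_TV n P Q = 1 / 2 * (\<Sum>i\<in>{1..n}. \<bar>pmf P i - pmf Q i\<bar>)"

text \<open>Only meaningful for finite nonempty \<open>S\<close>. The explicit probabilities are stated in
  \<open>pmf_COND_pos\<close> and \<open>pmf_COND_zero\<close> below.\<close>

definition COND :: "nat pmf \<Rightarrow> nat set \<Rightarrow> nat pmf" where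
  "COND D S = (if measure_pmf.prob D S > 0 then cond_pmf D S else pmf_of_set S)"

lemma pmf_COND_pos:
  assumes "measure_pmf.prob D S > 0"
  shows "pmf (COND D S) j = (if j \<in> S then pmf D j / measure_pmf.prob D S else 0)"
proof -
  have "set_pmf D \<inter> S \<noteq> {}"
    using assms by (auto simp: measure_pmf_zero_iff zero_less_measure_iff)
  then show ?thesis
    using assms by (simp add: COND_def pmf_cond)
qed

lemma pmf_COND_zero:
  assumes "measure_pmf.prob D S = 0" "finite S" "S \<noteq> {}"
  shows "pmf (COND D S) j = (if j \<in> S then 1 / card S else 0)"
  using assms by (simp add: COND_def)

text \<open>Each listed set is queried once for \<open>P\<close> and once for \<open>Q\<close>; all answers are independent.\<close>

primrec answers :: "nat pmf \<Rightarrow> nat pmf \<Rightarrow> nat set list \<Rightarrow> (nat \<times> nat) list pmf" where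
  "answers P Q [] = return_pmf []"
| "answers P Q (S # Ss) =
     bind_pmf (COND P S) (\<lambda>i.
     bind_pmf (COND Q S) (\<lambda>j.
     map_pmf (\<lambda>as. (i, j) # as) (answers P Q Ss)))"

datatype verdict = Accept | Reject

text \<open>A deterministic one-round adaptive tester: \<open>second_sets\<close> sees the first-round answers, \<open>decision\<close>
  sees the answers of both rounds. A randomized tester is a distribution over deterministic ones,
  i.e. all internal coins are drawn in advance, independently of the oracle answers.\<close>

record det_tester =
  first_sets :: "nat set list"
  second_sets :: "(nat \<times> nat) list \<Rightarrow> nat set list"
  decision :: "(nat \<times> nat) list \<Rightarrow> (nat \<times> nat) list \<Rightarrow> verdict"

type_synonym tester = "det_tester pmf"

definition query_sets :: "nat \<Rightarrow> nat \<Rightarrow> nat set list \<Rightarrow> bool" where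
  "query_sets n q Ss \<longleftrightarrow> length Ss = q \<and> (\<forall>S\<in>set Ss. S \<subseteq> {1..n} \<and> S \<noteq> {})"

text \<open>The second round only has to be well-formed on answers that the oracles can give.\<close>

definition one_round_adaptive :: "nat \<Rightarrow> nat \<Rightarrow> nat \<Rightarrow> tester \<Rightarrow> bool" where
  "one_round_adaptive n q1 q2 T \<longleftrightarrow>
     (\<forall>t\<in>set_pmf T. query_sets n q1 (first_sets t) \<and>
        (\<forall>as. list_all2 (\<lambda>S (i, j). i \<in> S \<and> j \<in> S) (first_sets t) as \<longrightarrow>
              query_sets n q2 (second_sets t as)))"

definition run :: "tester \<Rightarrow> nat pmf \<Rightarrow> nat pmf \<Rightarrow> verdict pmf" where
  "run T P Q =
     bind_pmf T (\<lambda>t.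
     bind_pmf (answers P Q (first_sets t)) (\<lambda>as.
     map_pmf (decision t as) (answers P Q (second_sets t as))))"

definition query_complexity :: "nat \<Rightarrow> nat \<Rightarrow> nat" where
  "query_complexity q1 q2 = 2 * (q1 + q2)"

definition equivalence_tester :: "nat \<Rightarrow> real \<Rightarrow> tester \<Rightarrow> bool" where
  "equivalence_tester n \<epsilon> T \<longleftrightarrow>
     (\<forall>P Q. dist_on n P \<longrightarrow> dist_on n Q \<longrightarrow>
        (P = Q \<longrightarrow> pmf (run T P Q) Accept \<ge> 2 / 3) \<and>
        (d_TV n P Q \<ge> \<epsilon> \<longrightarrow> pmf (run T P Q) Reject \<ge> 2 / 3))"

end

theory Submission
  imports Defs
begin

text \<open>
  Draw \<open>v\<close> from \<open>P\<close> or \<open>Q\<close> in the first round. In the second round, put \<open>v\<close> into a random set \<open>S\<close>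
  containing each element independently with probability \<open>(1/2)^k\<close>, for a random scale
  \<open>k = O(log n + log (1/\<epsilon>))\<close>, and compare how often \<open>v\<close> is returned by the two oracles on
  \<open>S \<union> {v}\<close>. Only \<open>log n\<close> densities matter, so one round replaces a binary search.

  Write \<open>w = P + Q\<close>. The two frequencies differ by at least \<open>4 \<bar>X(S)\<bar> / w(S \<union> {v})\<^sup>2\<close>, where
  \<open>X(S) = P(v) Q(S) - Q(v) P(S)\<close>. At density about \<open>w(v)\<close>, the set \<open>S\<close> avoids all elements heavier
  than \<open>v\<close> with constant probability, and then \<open>w(S)\<close> is \<open>O(w(v))\<close> up to exponential tails; so the
  expected gap is governed by \<open>X(L v)\<close>, where \<open>L v\<close> consists of the elements not heavier than \<open>v\<close>.
  Adding the elements in order of increasing weight, a telescoping argument shows that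
  \<open>\<Sum>v. \<bar>X(L v)\<bar>\<close> is at least \<open>d_TV\<^sup>2 / 2\<close>. After truncating the tail at \<open>w(S) \<le> C w(v)\<close> with
  \<open>C\<close> of order \<open>\<epsilon>\<close> to the power \<open>-1/4\<close>, the average gap at the right scale is of order \<open>\<epsilon>\<close> to
  the power \<open>5/2\<close>.
\<close>

section \<open>The gap along initial segments\<close>

text \<open>Induction adds the elements in order of increasing weight; the segment of a new element
  is everything present after its insertion. The last summand, total weight times absolute
  imbalance, makes the claim inductive: it is nonzero for partial sets and vanishes once
  \<open>p\<close> and \<open>q\<close> have equal total mass.\<close>

lemma initial_segment_gap:
  fixes w :: "'a \<Rightarrow> real" and p q :: "'a \<Rightarrow> real"
  assumes "finite A" and w: "\<And>x. w x = p x + q x"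
    and nonneg: "\<And>x. 0 \<le> p x" "\<And>x. 0 \<le> q x"
  shows "\<exists>L. (\<forall>x\<in>A. L x \<subseteq> A \<and> (\<forall>y\<in>L x. w y \<le> w x) \<and> (\<forall>y\<in>A - L x. w x \<le> w y)) \<and>
     (\<Sum>x\<in>A. \<bar>(q x - p x) / 2\<bar>)\<^sup>2
       \<le> 2 * (\<Sum>x\<in>A. \<bar>p x * (\<Sum>y\<in>L x. q y) - q x * (\<Sum>y\<in>L x. p y)\<bar>)
         + (\<Sum>x\<in>A. w x) * \<bar>\<Sum>x\<in>A. (q x - p x) / 2\<bar>"
  using \<open>finite A\<close>
proof (induction rule: finite_ranking_induct[where f = w])
  case empty
  then show ?case by simp
next
  case (insert x A)
  show ?case
  proof (cases "x \<in> A")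
    case True
    with insert.IH show ?thesis by (simp add: insert_absorb)
  next
    case False
    define c where "c = (\<lambda>x. (q x - p x) / 2)"
    obtain L where L: "\<forall>x\<in>A. L x \<subseteq> A \<and> (\<forall>y\<in>L x. w y \<le> w x) \<and> (\<forall>y\<in>A - L x. w x \<le> w y)"
      and IH: "(\<Sum>x\<in>A. \<bar>c x\<bar>)\<^sup>2
       \<le> 2 * (\<Sum>x\<in>A. \<bar>p x * (\<Sum>y\<in>L x. q y) - q x * (\<Sum>y\<in>L x. p y)\<bar>)
         + (\<Sum>x\<in>A. w x) * \<bar>\<Sum>x\<in>A. c x\<bar>"
      using insert.IH unfolding c_def by (elim exE conjE)
    \<comment> \<open>The new element is at least as heavy as all earlier ones, so the whole current
      set can serve as its segment, ties included, and the earlier segments stay valid.\<close>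
    define L' where "L' = L(x := insert x A)"
    define Z where "Z = (\<lambda>L z. \<bar>p z * (\<Sum>y\<in>L z. q y) - q z * (\<Sum>y\<in>L z. p y)\<bar>)"
    define B where "B = (\<Sum>x\<in>A. c x)"
    define M where "M = (\<Sum>x\<in>A. w x)"
    define C where "C = (\<Sum>x\<in>A. \<bar>c x\<bar>)"
    have w0: "0 \<le> w z" for z using w nonneg by (simp add: add_nonneg_nonneg)
    have M0: "0 \<le> M" unfolding M_def by (intro sum_nonneg w0)
    have C0: "0 \<le> C" unfolding C_def by (intro sum_nonneg) auto
    have c2: "2 * \<bar>c z\<bar> \<le> w z" for z
      using w[of z] nonneg(1)[of z] nonneg(2)[of z] by (auto simp: c_def)
    have C2: "2 * C \<le> M"
      unfolding C_def M_def sum_distrib_left by (intro sum_mono c2)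
    have sums: "(\<Sum>y\<in>A. q y) = M / 2 + B" "(\<Sum>y\<in>A. p y) = M / 2 - B"
      unfolding M_def B_def c_def sum_divide_distrib sum.distrib[symmetric] sum_subtractf[symmetric]
      by (auto intro!: sum.cong simp: w field_simps)
    \<comment> \<open>Writing \<open>p = w/2 - c\<close> and \<open>q = w/2 + c\<close>, the cross
      term collapses to weight times new imbalance minus \<open>c\<close> times new total
      weight.\<close>
    have Zx: "Z L' x = \<bar>w x * (B + c x) - c x * (M + w x)\<bar>"
      using False \<open>finite A\<close> unfolding Z_def L'_def
      by (simp add: sums w c_def field_simps)
    have Zs: "sum (Z L') (insert x A) = Z L' x + sum (Z L) A"
      using False \<open>finite A\<close> by (auto simp: Z_def L'_def intro!: sum.cong)
    \<comment> \<open>Two triangle inequalities for the same quantity \<open>Z L' x\<close>: this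
      one pays for the growth of the squared sum, the next one for the change of the imbalance term.
      Using both is the source of the factor 2 in the claim.\<close>
    have "\<bar>c x\<bar> * (M + w x) - w x * \<bar>B + c x\<bar> \<le> Z L' x"
    proof -
      have "\<bar>c x * (M + w x)\<bar> - \<bar>w x * (B + c x)\<bar> \<le> Z L' x" unfolding Zx by linarith
      then show ?thesis using w0[of x] M0 by (simp add: abs_mult)
    qed
    moreover have "(M + w x) * \<bar>B\<bar> - M * \<bar>B + c x\<bar> \<le> Z L' x"
    proof -
      have "(M + w x) * B = M * (B + c x) + (w x * (B + c x) - c x * (M + w x))"
        by (simp add: algebra_simps)
      then have "\<bar>(M + w x) * B\<bar> \<le> \<bar>M * (B + c x)\<bar> + Z L' x" unfolding Zx by linarith
      then show ?thesis using w0[of x] M0 by (simp add: abs_mult)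
    qed
    ultimately have "\<bar>c x\<bar> * (M + w x) + (w x) * \<bar>B\<bar> + M * \<bar>B\<bar>
         \<le> 2 * Z L' x + (M + w x) * \<bar>B + c x\<bar>"
      by (simp add: algebra_simps)
    moreover have "\<bar>c x\<bar> * (2 * C + 2 * \<bar>c x\<bar>) \<le> \<bar>c x\<bar> * (M + w x)"
      using C2 c2[of x] by (intro mult_left_mono) auto
    moreover have "0 \<le> w x * \<bar>B\<bar>" using w0 by auto
    moreover have "C\<^sup>2 \<le> 2 * sum (Z L) A + M * \<bar>B\<bar>"
      using IH unfolding C_def Z_def M_def B_def .
    ultimately have "(C + \<bar>c x\<bar>)\<^sup>2 \<le> 2 * (Z L' x + sum (Z L) A) + (M + w x) * \<bar>B + c x\<bar>"
    proof -
      have "(C + \<bar>c x\<bar>)\<^sup>2 \<le> C\<^sup>2 + \<bar>c x\<bar> * (2 * C + 2 * \<bar>c x\<bar>)"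
      proof -
        have "(C + \<bar>c x\<bar>)\<^sup>2 = C\<^sup>2 + \<bar>c x\<bar> * (2 * C + \<bar>c x\<bar>)"
          unfolding power2_eq_square by (simp only: algebra_simps)
        also have "\<dots> \<le> C\<^sup>2 + \<bar>c x\<bar> * (2 * C + 2 * \<bar>c x\<bar>)"
          by (intro add_left_mono mult_left_mono) auto
        finally show ?thesis .
      qed
      then show "\<lbrakk>\<bar>c x\<bar> * (M + w x) + (w x) * \<bar>B\<bar> + M * \<bar>B\<bar> \<le> 2 * Z L' x + (M + w x) * \<bar>B + c x\<bar>;
          \<bar>c x\<bar> * (2 * C + 2 * \<bar>c x\<bar>) \<le> \<bar>c x\<bar> * (M + w x); 0 \<le> w x * \<bar>B\<bar>;
          C\<^sup>2 \<le> 2 * sum (Z L) A + M * \<bar>B\<bar>\<rbrakk> \<Longrightarrow> ?thesis"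
        by (simp add: distrib_left)
    qed
    moreover have "\<forall>z\<in>insert x A. L' z \<subseteq> insert x A \<and> (\<forall>y\<in>L' z. w y \<le> w z) \<and>
        (\<forall>y\<in>insert x A - L' z. w z \<le> w y)"
      using L insert.hyps False unfolding L'_def by auto
    ultimately show ?thesis
      using False \<open>finite A\<close> Zs unfolding Z_def C_def B_def M_def c_def
      by (intro exI[of _ L']) (simp add: add.commute)
  qed
qed

section \<open>Random conditioning sets\<close>

definition random_subset :: "nat \<Rightarrow> real \<Rightarrow> nat set pmf" where
  "random_subset n r = map_pmf (\<lambda>f. {x \<in> {1..n}. f x}) (Pi_pmf {1..n} False (\<lambda>_. bernoulli_pmf r))"

lemma set_pmf_random_subset: "set_pmf (random_subset n r) \<subseteq> Pow {1..n}"
  unfolding random_subset_def by auto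

lemma finite_set_pmf_random_subset [simp]: "finite (set_pmf (random_subset n r))"
  using set_pmf_random_subset by (rule finite_subset) simp

text \<open>Memberships of different elements are independent, so the expectation factors. The
  indicators and exponential moments below are encoded as products of this shape.\<close>

lemma expectation_random_subset_prod:
  assumes "0 \<le> r" "r \<le> 1" and "\<And>x. 0 \<le> a x" "\<And>x. 0 \<le> b x"
  shows "measure_pmf.expectation (random_subset n r) (\<lambda>S. \<Prod>x\<in>{1..n}. if x \<in> S then a x else b x)
    = (\<Prod>x\<in>{1..n}. r * a x + (1 - r) * b x :: real)"
proof -
  have "measure_pmf.expectation (random_subset n r) (\<lambda>S. \<Prod>x\<in>{1..n}. if x \<in> S then a x else b x)
     = measure_pmf.expectation (Pi_pmf {1..n} False (\<lambda>_. bernoulli_pmf r))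
         (\<lambda>f. \<Prod>x\<in>{1..n}. if f x then a x else b x)"
    unfolding random_subset_def integral_map_pmf by (intro Bochner_Integration.integral_cong) (auto intro!: prod.cong)
  also have "\<dots> = (\<Prod>x\<in>{1..n}. measure_pmf.expectation (bernoulli_pmf r) (\<lambda>t. if t then a x else b x))"
    using assms by (intro expectation_prod_Pi_pmf[where f = "\<lambda>x t. if t then a x else b x"])
      (auto intro!: integrable_measure_pmf_finite)
  also have "\<dots> = (\<Prod>x\<in>{1..n}. r * a x + (1 - r) * b x)"
    using assms by (simp add: algebra_simps)
  finally show ?thesis .
qed

text \<open>If \<open>p\<close> and \<open>q\<close> are the masses of \<open>A\<close>, both
  positive, the two answer probabilities at \<open>v\<close> differ by the cross term divided by
  \<open>p * q\<close>, and \<open>4 * p * q\<close> is at most the square of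
  \<open>p + q\<close>.\<close>

lemma COND_gap:
  assumes A: "finite A" "v \<in> A"
  shows "4 * \<bar>\<Sum>x\<in>A. pmf P v * pmf Q x - pmf Q v * pmf P x\<bar>
    \<le> \<bar>pmf (COND P A) v - pmf (COND Q A) v\<bar> * (\<Sum>x\<in>A. pmf P x + pmf Q x)\<^sup>2"
proof -
  define p q where "p = measure_pmf.prob P A" and "q = measure_pmf.prob Q A"
  have pq: "p = (\<Sum>x\<in>A. pmf P x)" "q = (\<Sum>x\<in>A. pmf Q x)"
    unfolding p_def q_def using A by (simp_all add: measure_measure_pmf_finite)
  have X: "(\<Sum>x\<in>A. pmf P v * pmf Q x - pmf Q v * pmf P x) = pmf P v * q - pmf Q v * p"
    by (simp add: pq sum_subtractf sum_distrib_left)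
  have le: "pmf P v \<le> p" "pmf Q v \<le> q"
    unfolding pq using A by (auto intro: member_le_sum)
  have nonneg: "0 \<le> pmf P v" "0 \<le> pmf Q v" by auto
  show ?thesis
  proof (cases "p > 0 \<and> q > 0")
    case True
    then have "pmf (COND P A) v = pmf P v / p" "pmf (COND Q A) v = pmf Q v / q"
      using A pmf_COND_pos unfolding p_def q_def by simp_all
    then have e: "\<bar>pmf (COND P A) v - pmf (COND Q A) v\<bar> = \<bar>pmf P v * q - pmf Q v * p\<bar> / (p * q)"
    proof -
      have "pmf P v / p - pmf Q v / q = (pmf P v * q - pmf Q v * p) / (p * q)"
        using True by (simp add: field_simps)
      then show ?thesis using True \<open>pmf (COND P A) v = pmf P v / p\<close> \<open>pmf (COND Q A) v = pmf Q v / q\<close>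
        by (simp add: abs_mult)
    qed
    have "4 * (p * q) \<le> (p + q)\<^sup>2"
      using sum_squares_ge_zero[of "p - q" 0] by (simp add: power2_eq_square algebra_simps)
    then have "4 * (p * q) * (\<bar>pmf P v * q - pmf Q v * p\<bar> / (p * q))
       \<le> (p + q)\<^sup>2 * (\<bar>pmf P v * q - pmf Q v * p\<bar> / (p * q))"
      using True by (intro mult_right_mono) auto
    moreover have "4 * (p * q) * (\<bar>pmf P v * q - pmf Q v * p\<bar> / (p * q)) = 4 * \<bar>pmf P v * q - pmf Q v * p\<bar>"
      using True by simp
    ultimately show ?thesis unfolding X e sum.distrib pq[symmetric] by (simp only: mult.commute)
  next
    case False
    \<comment> \<open>If one mass of \<open>A\<close> is zero, so is the corresponding mass of
      \<open>v\<close>, and both products vanish. The uniform fallback of the oracle therefore does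
      no harm.\<close>
    then have "pmf P v * q - pmf Q v * p = 0"
      using le nonneg by (smt (verit) mult_eq_0_iff)
    then show ?thesis unfolding X by simp
  qed
qed

lemma power_div_fact_le_exp:
  fixes x :: real
  assumes "0 \<le> x"
  shows "x ^ n / fact n \<le> exp x"
proof -
  have "(\<lambda>k. x ^ k / fact k) sums exp x" using exp_converges[of x] by (simp add: scaleR_conv_of_real field_simps)
  then have "sum (\<lambda>k. x ^ k / fact k) {n} \<le> exp x"
    using assms by (intro sum_le_suminf[THEN order.trans, OF _ _ _ eq_refl])
      (auto simp: sums_iff)
  then show ?thesis by simp
qed

definition gap :: "nat pmf \<Rightarrow> nat pmf \<Rightarrow> nat \<Rightarrow> nat set \<Rightarrow> real" where
  "gap P Q v S = pmf (COND P (insert v S)) v - pmf (COND Q (insert v S)) v"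

lemma sum_pmf_dist_on: "dist_on n P \<Longrightarrow> (\<Sum>x\<in>{1..n}. pmf P x) = 1"
  unfolding dist_on_def by (rule sum_pmf_eq_1) auto

section \<open>Moments of the random set on the event that it avoids the heavier elements\<close>

lemma expectation_random_subset_member_avoid:
  fixes r :: real
  assumes "0 \<le> r" "r \<le> 1" "L \<subseteq> {1..n}" "y \<in> L"
  shows "measure_pmf.expectation (random_subset n r) (\<lambda>S. of_bool (y \<in> S) * of_bool (S \<subseteq> L))
    = r * (1 - r) ^ card ({1..n} - L)"
proof -
  \<comment> \<open>The event is a product of local conditions: an element inside \<open>S\<close>
    must belong to \<open>L\<close>, an element outside \<open>S\<close> must differ from
    \<open>y\<close>.\<close>
  have "measure_pmf.expectation (random_subset n r) (\<lambda>S. of_bool (y \<in> S) * of_bool (S \<subseteq> L) :: real)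
    = measure_pmf.expectation (random_subset n r)
        (\<lambda>S. \<Prod>x\<in>{1..n}. if x \<in> S then of_bool (x \<in> L) else of_bool (x \<noteq> y))"
  proof (intro integral_cong_AE AE_pmfI)
    fix S assume "S \<in> set_pmf (random_subset n r)"
    then have S: "S \<subseteq> {1..n}" using set_pmf_random_subset by blast
    have y: "y \<in> {1..n}" using assms by auto
    have "y \<notin> S \<or> \<not> S \<subseteq> L \<Longrightarrow> \<exists>x\<in>{1..n}. (if x \<in> S then of_bool (x \<in> L) else of_bool (x \<noteq> y)) = (0::real)"
      using S y by auto
    moreover have "y \<in> S \<Longrightarrow> S \<subseteq> L \<Longrightarrow> (\<Prod>x\<in>{1..n}. if x \<in> S then of_bool (x \<in> L) else of_bool (x \<noteq> y)) = (1::real)"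
      by (intro prod.neutral) auto
    ultimately show "(of_bool (y \<in> S) * of_bool (S \<subseteq> L) :: real)
        = (\<Prod>x\<in>{1..n}. if x \<in> S then of_bool (x \<in> L) else of_bool (x \<noteq> y))"
      by (cases "y \<in> S \<and> S \<subseteq> L") (auto simp: prod_zero)
  qed auto
  also have "\<dots> = (\<Prod>x\<in>{1..n}. r * of_bool (x \<in> L) + (1 - r) * of_bool (x \<noteq> y))"
    using assms by (intro expectation_random_subset_prod) auto
  also have "\<dots> = (\<Prod>x\<in>{1..n} - L. r * of_bool (x \<in> L) + (1 - r) * of_bool (x \<noteq> y))
      * (\<Prod>x\<in>L. r * of_bool (x \<in> L) + (1 - r) * of_bool (x \<noteq> y))"
    using assms by (intro prod.subset_diff) auto
  also have "(\<Prod>x\<in>{1..n} - L. r * of_bool (x \<in> L) + (1 - r) * of_bool (x \<noteq> y)) = (\<Prod>x\<in>{1..n} - L. 1 - r)"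
    using assms by (intro prod.cong) auto
  also have "(\<Prod>x\<in>L. r * of_bool (x \<in> L) + (1 - r) * of_bool (x \<noteq> y)) = (\<Prod>x\<in>L. if x = y then r else 1)"
    by (intro prod.cong) auto
  also have "\<dots> = r" using assms finite_subset[OF assms(3)] by simp
  finally show ?thesis by (simp add: mult.commute)
qed

text \<open>Each element of \<open>L\<close> contributes a factor
  \<open>1 + r * (exp u - 1)\<close>, at most \<open>exp (2 * r * u)\<close> because
  \<open>exp u \<le> 1 + 2 * u\<close> on the unit interval. Each element outside \<open>L\<close>
  contributes the probability \<open>1 - r\<close> of being left out.\<close>

lemma expectation_random_subset_exp_avoid:
  fixes r :: real
  assumes "0 \<le> r" "r \<le> 1" "L \<subseteq> {1..n}" and u: "\<And>x. x \<in> L \<Longrightarrow> 0 \<le> u x \<and> u x \<le> 1"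
  shows "measure_pmf.expectation (random_subset n r) (\<lambda>S. exp (\<Sum>x\<in>S. u x) * of_bool (S \<subseteq> L))
    \<le> exp (2 * r * (\<Sum>x\<in>L. u x)) * (1 - r) ^ card ({1..n} - L)"
proof -
  have fin: "finite L" using finite_subset[OF assms(3)] by simp
  have "measure_pmf.expectation (random_subset n r) (\<lambda>S. exp (\<Sum>x\<in>S. u x) * of_bool (S \<subseteq> L))
    = measure_pmf.expectation (random_subset n r)
        (\<lambda>S. \<Prod>x\<in>{1..n}. if x \<in> S then (if x \<in> L then exp (u x) else 0) else 1)"
  proof (intro integral_cong_AE AE_pmfI)
    fix S assume "S \<in> set_pmf (random_subset n r)"
    then have S: "S \<subseteq> {1..n}" using set_pmf_random_subset by blast
    have "(\<Prod>x\<in>{1..n}. if x \<in> S then (if x \<in> L then exp (u x) else 0) else 1)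
       = (\<Prod>x\<in>S. if x \<in> L then exp (u x) else 0 :: real)"
      using S by (subst prod.inter_restrict[symmetric]) (auto simp: Int_absorb1)
    also have "\<dots> = exp (\<Sum>x\<in>S. u x) * of_bool (S \<subseteq> L)"
    proof (cases "S \<subseteq> L")
      case True
      then have "(\<Prod>x\<in>S. if x \<in> L then exp (u x) else 0 :: real) = (\<Prod>x\<in>S. exp (u x))"
        by (intro prod.cong) auto
      then show ?thesis using True S finite_subset[OF S] by (simp add: exp_sum)
    next
      case False
      then have "\<exists>x\<in>S. (if x \<in> L then exp (u x) else 0 :: real) = 0" by auto
      then show ?thesis using False finite_subset[OF S] by (simp add: prod_zero)
    qed
    finally show "exp (\<Sum>x\<in>S. u x) * of_bool (S \<subseteq> L)
       = (\<Prod>x\<in>{1..n}. if x \<in> S then (if x \<in> L then exp (u x) else 0) else 1)" ..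
  qed auto
  also have "\<dots> = (\<Prod>x\<in>{1..n}. r * (if x \<in> L then exp (u x) else 0) + (1 - r) * 1)"
    using assms by (intro expectation_random_subset_prod) auto
  also have "\<dots> = (\<Prod>x\<in>{1..n} - L. r * (if x \<in> L then exp (u x) else 0) + (1 - r) * 1)
      * (\<Prod>x\<in>L. r * (if x \<in> L then exp (u x) else 0) + (1 - r) * 1)"
    using assms by (intro prod.subset_diff) auto
  also have "(\<Prod>x\<in>{1..n} - L. r * (if x \<in> L then exp (u x) else 0) + (1 - r) * 1) = (1 - r) ^ card ({1..n} - L)"
    by simp
  also have "(1 - r) ^ card ({1..n} - L) * (\<Prod>x\<in>L. r * (if x \<in> L then exp (u x) else 0) + (1 - r) * 1)
      \<le> (1 - r) ^ card ({1..n} - L) * (\<Prod>x\<in>L. exp (2 * r * u x))"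
  proof (intro mult_left_mono prod_mono conjI)
    fix x assume x: "x \<in> L"
    have "exp (u x) \<le> 1 + 2 * u x"
    proof -
      have "exp (u x) \<le> 1 + u x + (u x)\<^sup>2" using u[OF x] by (intro exp_bound) auto
      also have "(u x)\<^sup>2 \<le> u x" using u[OF x] by (simp add: power2_eq_square mult_left_le)
      finally show ?thesis by simp
    qed
    then have "r * exp (u x) \<le> r * (1 + 2 * u x)" using assms by (intro mult_left_mono)
    then have "r * exp (u x) + (1 - r) \<le> 1 + 2 * r * u x" by (simp add: algebra_simps)
    also have "\<dots> \<le> exp (2 * r * u x)" by (rule exp_ge_add_one_self)
    finally show "r * (if x \<in> L then exp (u x) else 0) + (1 - r) * 1 \<le> exp (2 * r * u x)" using x by simp
  qed (use assms in auto)
  also have "(\<Prod>x\<in>L. exp (2 * r * u x)) = exp (2 * r * (\<Sum>x\<in>L. u x))"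
    using fin by (simp add: exp_sum sum_distrib_left)
  finally show ?thesis by (simp only: mult.commute)
qed

text \<open>The expectation is restricted to sets inside \<open>L\<close> and bounded below by a
  linear functional of the cross terms, whose expectation is explicit. The subtracted term bounds
  the sets of weight above \<open>C * w v\<close> through an exponential moment.\<close>

lemma expected_gap_lower_bound:
  fixes P Q :: "nat pmf" and C r :: real
  defines "w \<equiv> \<lambda>x. pmf P x + pmf Q x"
  assumes PQ: "dist_on n P" "dist_on n Q" and v: "v \<in> {1..n}" "0 < w v"
    and L: "L \<subseteq> {1..n}" "\<And>x. x \<in> L \<Longrightarrow> w x \<le> w v" "\<And>x. x \<in> {1..n} - L \<Longrightarrow> w v \<le> w x"
    and r: "w v / 8 \<le> r" "r \<le> w v / 4" and C: "0 < C"
  shows "4 / (1 + C)\<^sup>2 * (\<bar>\<Sum>x\<in>L. pmf P v * pmf Q x - pmf Q v * pmf P x\<bar> / 16 - w v * fact 9 * exp 1 / C ^ 8)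
    \<le> w v * measure_pmf.expectation (random_subset n r) (\<lambda>S. \<bar>gap P Q v S\<bar>)"
proof -
  define X where "X = (\<lambda>x. pmf P v * pmf Q x - pmf Q v * pmf P x)"
  define T where "T = (\<Sum>x\<in>L. X x)"
  \<comment> \<open>Multiplying by the sign of the total \<open>T\<close> replaces absolute values
    of the random sums by a linear expression, so expectations can be taken term by term.\<close>
  define \<sigma> where "\<sigma> = sgn T"
  define h where "h = (1 - r) ^ card ({1..n} - L)"
  define K where "K = (w v)\<^sup>2 * fact 9 / C ^ 8"
  define E where "E f = measure_pmf.expectation (random_subset n r) f" for f :: "nat set \<Rightarrow> real"
  have w0: "0 \<le> w x" for x unfolding w_def by simp
  have Xw: "\<bar>X x\<bar> \<le> w v * w x" for x
  proof -
    have "\<bar>X x\<bar> \<le> pmf P v * pmf Q x + pmf Q v * pmf P x"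
      unfolding X_def by (rule order.trans[OF abs_triangle_ineq4]) (simp add: abs_mult)
    also have "\<dots> \<le> w v * w x" unfolding w_def by (simp add: algebra_simps)
    finally show ?thesis .
  qed
  have sumw: "(\<Sum>x\<in>{1..n}. w x) = 2"
    unfolding w_def by (simp only: sum.distrib sum_pmf_dist_on[OF PQ(1)] sum_pmf_dist_on[OF PQ(2)] one_add_one)
  have wv: "w v \<le> 2" using v member_le_sum[of v "{1..n}" w] w0 sumw by simp
  have r01: "0 \<le> r" "r \<le> 1" using r v wv by auto
  have fin: "finite L" using finite_subset[OF L(1)] by simp
  have \<sigma>: "\<bar>\<sigma>\<bar> \<le> 1" "\<sigma> * T = \<bar>T\<bar>" unfolding \<sigma>_def by (auto simp: sgn_if)
  have int: "integrable (random_subset n r) f" for f :: "nat set \<Rightarrow> real"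
    by (rule integrable_measure_pmf_finite) simp

  text \<open>The exponential term pays for the sets with \<open>w(S) > C w(v)\<close>, where the left-hand side is
    at most 0 because \<open>y \<le> 9! exp y / C^8\<close> for \<open>y > C\<close>.\<close>
  have pointwise: "\<sigma> * (\<Sum>x\<in>L. X x * (of_bool (x \<in> S) * of_bool (S \<subseteq> L)))
      - K * (exp (\<Sum>x\<in>S. w x / w v) * of_bool (S \<subseteq> L))
     \<le> \<bar>gap P Q v S\<bar> * (((1 + C) * w v)\<^sup>2 / 4)"
    if "S \<subseteq> {1..n}" for S
  proof (cases "S \<subseteq> L")
    case False
    then show ?thesis by simp
  next
    case True
    have finS: "finite S" using that finite_subset by blast
    define W where "W = (\<Sum>x\<in>S. w x)"
    have W0: "0 \<le> W" unfolding W_def by (intro sum_nonneg w0)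
    have "(\<Sum>x\<in>L. X x * (of_bool (x \<in> S) * of_bool (S \<subseteq> L))) = (\<Sum>x\<in>L. if x \<in> S then X x else 0)"
      using True by (intro sum.cong) auto
    also have "\<dots> = (\<Sum>x\<in>S. X x)"
      using True fin by (subst sum.inter_restrict[symmetric]) (auto simp: Int_absorb1)
    finally have sX: "(\<Sum>x\<in>L. X x * (of_bool (x \<in> S) * of_bool (S \<subseteq> L))) = sum X S" .
    have "\<bar>\<sigma> * sum X S\<bar> \<le> \<bar>sum X S\<bar>"
      using \<sigma>(1) by (simp add: abs_mult mult_left_le_one_le)
    then have \<sigma>X: "\<sigma> * sum X S \<le> \<bar>sum X S\<bar>" by linarith
    have K0: "0 \<le> K" unfolding K_def using C by simp
    have "\<bar>sum X S\<bar> - K * exp (W / w v) \<le> \<bar>gap P Q v S\<bar> * (((1 + C) * w v)\<^sup>2 / 4)"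
    proof (cases "W \<le> C * w v")
      case W: True
      have "4 * \<bar>\<Sum>x\<in>insert v S. X x\<bar> \<le> \<bar>gap P Q v S\<bar> * (\<Sum>x\<in>insert v S. w x)\<^sup>2"
        unfolding X_def gap_def w_def using finS by (intro COND_gap) auto
      \<comment> \<open>The cross term of \<open>v\<close> with itself is zero, so inserting the
        pivot affects only the weight of the set.\<close>
      moreover have "(\<Sum>x\<in>insert v S. X x) = sum X S"
        using finS by (cases "v \<in> S") (simp_all add: insert_absorb X_def)
      moreover have "(\<Sum>x\<in>insert v S. w x) \<le> (1 + C) * w v"
        using finS W v by (cases "v \<in> S") (simp_all add: insert_absorb W_def[symmetric] algebra_simps)
      then have "\<bar>gap P Q v S\<bar> * (\<Sum>x\<in>insert v S. w x)\<^sup>2 \<le> \<bar>gap P Q v S\<bar> * ((1 + C) * w v)\<^sup>2"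
        by (intro mult_left_mono power_mono sum_nonneg w0) auto
      ultimately have "\<bar>sum X S\<bar> \<le> \<bar>gap P Q v S\<bar> * (((1 + C) * w v)\<^sup>2 / 4)" by simp
      then show ?thesis using K0 by (smt (verit) mult_nonneg_nonneg exp_ge_zero)
    next
      case W: False
      define y where "y = W / w v"
      have y: "C < y" using W v unfolding y_def by (simp add: field_simps)
      have "\<bar>sum X S\<bar> \<le> (\<Sum>x\<in>S. w v * w x)" by (rule order.trans[OF sum_abs]) (intro sum_mono Xw)
      also have "\<dots> = (w v)\<^sup>2 * y"
        using v unfolding y_def W_def by (simp add: sum_distrib_left[symmetric] power2_eq_square)
      also have "y \<le> fact 9 * exp y / C ^ 8"
      proof -
        have "y * C ^ 8 \<le> y * y ^ 8" using y C by (intro mult_left_mono power_mono) auto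
        also have "\<dots> = y ^ 9" by (simp add: numeral_eq_Suc)
        also have "\<dots> \<le> fact 9 * exp y"
          using power_div_fact_le_exp[of y 9] y C by (simp add: field_simps)
        finally show ?thesis using C by (simp add: field_simps)
      qed
      finally have "\<bar>sum X S\<bar> \<le> K * exp y" unfolding K_def by (simp add: mult_left_mono)
      moreover have "0 \<le> \<bar>gap P Q v S\<bar> * (((1 + C) * w v)\<^sup>2 / 4)" by simp
      ultimately show ?thesis unfolding y_def by linarith
    qed
    then show ?thesis using \<sigma>X True unfolding sX W_def sum_divide_distrib by simp
  qed

  have "E (\<lambda>S. \<sigma> * (\<Sum>x\<in>L. X x * (of_bool (x \<in> S) * of_bool (S \<subseteq> L)))
      - K * (exp (\<Sum>x\<in>S. w x / w v) * of_bool (S \<subseteq> L)))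
     \<le> E (\<lambda>S. \<bar>gap P Q v S\<bar> * (((1 + C) * w v)\<^sup>2 / 4))"
    unfolding E_def using set_pmf_random_subset pointwise
    by (intro integral_mono_AE int AE_pmfI) blast
  also have "E (\<lambda>S. \<sigma> * (\<Sum>x\<in>L. X x * (of_bool (x \<in> S) * of_bool (S \<subseteq> L)))
      - K * (exp (\<Sum>x\<in>S. w x / w v) * of_bool (S \<subseteq> L)))
     = \<sigma> * (\<Sum>x\<in>L. X x * E (\<lambda>S. of_bool (x \<in> S) * of_bool (S \<subseteq> L)))
       - K * E (\<lambda>S. exp (\<Sum>x\<in>S. w x / w v) * of_bool (S \<subseteq> L))"
    unfolding E_def by (simp add: int Bochner_Integration.integral_sum del: of_bool_conj)
  also have "(\<Sum>x\<in>L. X x * E (\<lambda>S. of_bool (x \<in> S) * of_bool (S \<subseteq> L))) = T * (r * h)"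
    unfolding T_def sum_distrib_right E_def h_def
    by (intro sum.cong refl arg_cong2[where f = "(*)"] expectation_random_subset_member_avoid r01 L) auto
  also have "\<sigma> * (T * (r * h)) = \<bar>T\<bar> * r * h" using \<sigma>(2) by simp
  finally have 1: "\<bar>T\<bar> * r * h - K * E (\<lambda>S. exp (\<Sum>x\<in>S. w x / w v) * of_bool (S \<subseteq> L))
      \<le> E (\<lambda>S. \<bar>gap P Q v S\<bar>) * (((1 + C) * w v)\<^sup>2 / 4)"
    unfolding E_def by simp
  \<comment> \<open>Every element outside \<open>L\<close> weighs at least \<open>w v\<close> and
    the total weight is 2, so there are at most \<open>2 / w v\<close> of them. With
    \<open>r \<le> w v / 4\<close>, Bernoulli's inequality gives one half.\<close>
  have h: "1 / 2 \<le> h" "h \<le> 1"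
  proof -
    have "(\<Sum>x\<in>{1..n} - L. w v) \<le> (\<Sum>x\<in>{1..n} - L. w x)" by (intro sum_mono L)
    also have "\<dots> \<le> (\<Sum>x\<in>{1..n}. w x)" by (intro sum_mono2) (auto simp: w0)
    finally have "real (card ({1..n} - L)) * w v \<le> 2" using sumw by simp
    moreover have "real (card ({1..n} - L)) * r \<le> real (card ({1..n} - L)) * (w v / 4)"
      using r by (intro mult_left_mono) auto
    ultimately have "1 / 2 \<le> 1 + real (card ({1..n} - L)) * (- r)" by simp
    also have "\<dots> \<le> (1 + - r) ^ card ({1..n} - L)" using r01 by (intro Bernoulli_inequality) simp
    finally show "1 / 2 \<le> h" unfolding h_def by simp
    show "h \<le> 1" unfolding h_def using r01 by (simp add: power_le_one)
  qed
  have "E (\<lambda>S. exp (\<Sum>x\<in>S. w x / w v) * of_bool (S \<subseteq> L)) \<le> exp (2 * r * (\<Sum>x\<in>L. w x / w v)) * h"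
    unfolding E_def h_def using r01 L v w0 by (intro expectation_random_subset_exp_avoid) auto
  also have "\<dots> \<le> exp 1 * 1"
  proof (intro mult_mono)
    \<comment> \<open>The density \<open>r \<le> w v / 4\<close> and the total weight 2 make the
      exponent at most 1.\<close>
    have "(\<Sum>x\<in>L. w x) \<le> 2" using sum_mono2[of "{1..n}" L w] L w0 sumw by simp
    then have "2 * r * (\<Sum>x\<in>L. w x) \<le> 2 * (w v / 4) * 2" using r r01 w0
      by (intro mult_mono) (auto intro: sum_nonneg)
    then show "exp (2 * r * (\<Sum>x\<in>L. w x / w v)) \<le> exp 1"
      using v unfolding sum_divide_distrib[symmetric] by (simp add: field_simps)
  qed (use h in auto)
  finally have "K * E (\<lambda>S. exp (\<Sum>x\<in>S. w x / w v) * of_bool (S \<subseteq> L)) \<le> K * exp 1"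
    using C by (intro mult_left_mono) (auto simp: K_def)
  moreover have "\<bar>T\<bar> * (w v / 8) * (1 / 2) \<le> \<bar>T\<bar> * r * h"
    using r r01 h w0[of v] by (intro mult_mono) auto
  ultimately have "\<bar>T\<bar> * w v / 16 - K * exp 1 \<le> E (\<lambda>S. \<bar>gap P Q v S\<bar>) * (((1 + C) * w v)\<^sup>2 / 4)"
    using 1 by simp
  \<comment> \<open>The normalisation leaves one factor \<open>w v\<close> on the right, which is
    twice the probability that \<open>v\<close> is the pivot.\<close>
  then have "4 / ((1 + C)\<^sup>2 * w v) * (\<bar>T\<bar> * w v / 16 - K * exp 1)
     \<le> 4 / ((1 + C)\<^sup>2 * w v) * (E (\<lambda>S. \<bar>gap P Q v S\<bar>) * (((1 + C) * w v)\<^sup>2 / 4))"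
    using v by (intro mult_left_mono) auto
  moreover have "4 / ((1 + C)\<^sup>2 * w v) * (E (\<lambda>S. \<bar>gap P Q v S\<bar>) * (((1 + C) * w v)\<^sup>2 / 4))
     = w v * E (\<lambda>S. \<bar>gap P Q v S\<bar>)"
  proof -
    have "4 / (c\<^sup>2 * x) * (e * ((c * x)\<^sup>2 / 4)) = x * e" if "0 < c" "0 < x" for c x e :: real
      using that by (simp add: field_simps power2_eq_square)
    from this[of "1 + C" "w v"] show ?thesis using v C by simp
  qed
  moreover have "4 / ((1 + C)\<^sup>2 * w v) * (\<bar>T\<bar> * w v / 16 - K * exp 1)
     = 4 / (1 + C)\<^sup>2 * (\<bar>T\<bar> / 16 - w v * fact 9 * exp 1 / C ^ 8)"
  proof -
    have "\<bar>T\<bar> * w v / 16 - K * exp 1 = w v * (\<bar>T\<bar> / 16 - w v * fact 9 * exp 1 / C ^ 8)"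
      unfolding K_def by (simp add: power2_eq_square algebra_simps)
    then show ?thesis using v by simp
  qed
  ultimately show ?thesis unfolding T_def X_def E_def by simp
qed

section \<open>Choosing the scale and summing over the pivots\<close>

lemma exists_dyadic_density:
  fixes w :: real
  assumes "w \<le> 2" "8 * (1 / 2) ^ K \<le> w"
  shows "\<exists>k\<in>{1..K}. w / 8 \<le> (1 / 2) ^ k \<and> (1 / 2) ^ k \<le> w / 4"
proof -
  define k where "k = (LEAST k. (1 / 2) ^ k \<le> w / 4)"
  have 0: "(0::real) < (1 / 2) ^ K" by simp
  then have K: "(1 / 2) ^ K \<le> w / 4" using assms by linarith
  have k: "(1 / 2) ^ k \<le> w / 4" unfolding k_def by (rule LeastI[where P = "\<lambda>k. (1 / 2) ^ k \<le> w / 4", OF K])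
  have "k \<le> K" unfolding k_def by (rule Least_le[where P = "\<lambda>k. (1 / 2) ^ k \<le> w / 4", OF K])
  \<comment> \<open>Density 1 is too large because \<open>w \<le> 2\<close>, so \<open>k\<close> has
    a predecessor. By minimality the predecessor violates the upper bound, which gives the lower
    bound for \<open>k\<close>.\<close>
  have "k \<noteq> 0" using k assms by (intro notI) simp
  then obtain j where j: "k = Suc j" using not0_implies_Suc by blast
  have "\<not> (1 / 2) ^ j \<le> w / 4"
    using not_less_Least[of j "\<lambda>k. (1 / 2) ^ k \<le> w / 4"] j unfolding k_def by simp
  then have "w / 8 \<le> (1 / 2) ^ k" unfolding j by simp
  then show ?thesis using k \<open>k \<le> K\<close> \<open>k \<noteq> 0\<close> by auto
qed

text \<open>Each pivot that is not too light has a dyadic density within a factor 2 of a quarter of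
  its weight. The bound for single pivots is summed over these, and the initial-segment inequality
  makes the main term at least of order \<open>\<epsilon>\<^sup>2\<close>.\<close>

lemma sum_expected_gap_lower_bound:
  fixes P Q :: "nat pmf" and \<epsilon> :: real
  defines "w \<equiv> \<lambda>x. pmf P x + pmf Q x"
  assumes PQ: "dist_on n P" "dist_on n Q" and \<epsilon>: "0 < \<epsilon>" "\<epsilon> \<le> 1" and far: "\<epsilon> \<le> d_TV n P Q"
    and n: "1 \<le> n" and K: "128 * real n / \<epsilon>\<^sup>2 \<le> 2 ^ K"
  shows "\<exists>k. (\<forall>v\<in>{1..n}. k v \<in> {1..K}) \<and>
    \<epsilon>\<^sup>2 * sqrt \<epsilon> / 2 ^ 14 \<le>
      (\<Sum>v\<in>{1..n}. w v * measure_pmf.expectation (random_subset n ((1 / 2) ^ k v)) (\<lambda>S. \<bar>gap P Q v S\<bar>))"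
proof -
  \<comment> \<open>Elements lighter than this contribute at most
    \<open>n * \<omega> = \<epsilon>\<^sup>2 / 16\<close> to the sum of the cross terms and are
    discarded.\<close>
  define \<omega> where "\<omega> = \<epsilon>\<^sup>2 / (16 * real n)"
  \<comment> \<open>The fourth root makes \<open>C ^ 8\<close> proportional to
    \<open>1 / \<epsilon>\<^sup>2\<close>, so the truncation error is a small multiple of
    \<open>\<epsilon>\<^sup>2\<close>, while dividing by \<open>(1 + C)\<^sup>2\<close> costs only a
    factor of order \<open>sqrt \<epsilon>\<close>.\<close>
  define C where "C = 16 / sqrt (sqrt \<epsilon>)"
  define I where "I = {1..n}"
  have finI: "finite I" unfolding I_def by simp
  have sumP: "sum (pmf P) I = 1" and sumQ: "sum (pmf Q) I = 1"
    unfolding I_def by (intro sum_pmf_dist_on PQ)+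
  have w0: "0 \<le> w x" for x unfolding w_def by simp
  have sumw: "sum w I = 2" unfolding w_def sum.distrib sumP sumQ by simp
  obtain L where L': "\<forall>v\<in>I. L v \<subseteq> I \<and> (\<forall>x\<in>L v. w x \<le> w v) \<and> (\<forall>x\<in>I - L v. w v \<le> w x)"
    and LZ: "(\<Sum>x\<in>I. \<bar>(pmf Q x - pmf P x) / 2\<bar>)\<^sup>2
       \<le> 2 * (\<Sum>x\<in>I. \<bar>pmf P x * (\<Sum>y\<in>L x. pmf Q y) - pmf Q x * (\<Sum>y\<in>L x. pmf P y)\<bar>)
         + (\<Sum>x\<in>I. w x) * \<bar>\<Sum>x\<in>I. (pmf Q x - pmf P x) / 2\<bar>"
    using initial_segment_gap[OF finI, of w "pmf P" "pmf Q", OF meta_eq_to_obj_eq[OF w_def, THEN fun_cong] pmf_nonneg pmf_nonneg]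
    by (elim exE conjE)
  have L: "\<And>v. v \<in> I \<Longrightarrow> L v \<subseteq> I" "\<And>v x. v \<in> I \<Longrightarrow> x \<in> L v \<Longrightarrow> w x \<le> w v"
      "\<And>v x. v \<in> I \<Longrightarrow> x \<in> I - L v \<Longrightarrow> w v \<le> w x"
    using L' by blast+
  define Z where "Z v = \<bar>\<Sum>x\<in>L v. pmf P v * pmf Q x - pmf Q v * pmf P x\<bar>" for v
  have Z: "Z v = \<bar>pmf P v * (\<Sum>y\<in>L v. pmf Q y) - pmf Q v * (\<Sum>y\<in>L v. pmf P y)\<bar>" for v
    unfolding Z_def by (simp add: sum_subtractf sum_distrib_left)
  \<comment> \<open>Both distributions have total mass 1, so the imbalance term drops out.\<close>
  have "(\<Sum>x\<in>I. (pmf Q x - pmf P x) / 2) = 0"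
    unfolding sum_divide_distrib[symmetric] sum_subtractf sumP sumQ by simp
  moreover have "(\<Sum>x\<in>I. \<bar>(pmf Q x - pmf P x) / 2\<bar>) = d_TV n P Q"
    unfolding d_TV_def I_def sum_distrib_left by (intro sum.cong) (auto simp: abs_minus_commute)
  ultimately have "(d_TV n P Q)\<^sup>2 \<le> 2 * sum Z I" using LZ unfolding Z by simp
  moreover have "\<epsilon>\<^sup>2 \<le> (d_TV n P Q)\<^sup>2" using far \<epsilon> by (intro power_mono) auto
  ultimately have sumZ: "\<epsilon>\<^sup>2 / 2 \<le> sum Z I" by simp
  define V where "V = {v \<in> I. \<omega> \<le> w v}"
  have V: "V \<subseteq> I" "finite V" using finI unfolding V_def by auto
  have "sum Z (I - V) \<le> (\<Sum>v\<in>I - V. \<omega>)"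
  proof (intro sum_mono)
    fix v assume v: "v \<in> I - V"
    have "0 \<le> sum (pmf Q) (L v)" "sum (pmf Q) (L v) \<le> 1" "0 \<le> sum (pmf P) (L v)" "sum (pmf P) (L v) \<le> 1"
      using v L(1)[of v] sum_mono2[OF finI L(1)[of v], of "pmf P"] sum_mono2[OF finI L(1)[of v], of "pmf Q"]
        sumP sumQ by (auto intro: sum_nonneg)
    then have "0 \<le> pmf P v * sum (pmf Q) (L v)" "pmf P v * sum (pmf Q) (L v) \<le> pmf P v"
      "0 \<le> pmf Q v * sum (pmf P) (L v)" "pmf Q v * sum (pmf P) (L v) \<le> pmf Q v"
      by (auto intro: mult_left_le)
    then have "Z v \<le> w v" unfolding Z w_def by linarith
    moreover have "w v < \<omega>" using v unfolding V_def by auto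
    ultimately show "Z v \<le> \<omega>" by simp
  qed
  also have "\<dots> \<le> real n * \<omega>"
  proof -
    have "card (I - V) \<le> n" using card_mono[OF finI, of "I - V"] unfolding I_def by auto
    moreover have "0 \<le> \<omega>" unfolding \<omega>_def by simp
    ultimately show ?thesis by (simp add: mult_right_mono)
  qed
  also have "\<dots> = \<epsilon>\<^sup>2 / 16" using n unfolding \<omega>_def by simp
  finally have sumZV: "3 / 8 * \<epsilon>\<^sup>2 \<le> sum Z V"
    using sumZ sum.subset_diff[OF V(1) finI, of Z] zero_le_power2[of \<epsilon>] by linarith

  have C: "1 \<le> C" "C ^ 8 = 2 ^ 32 / \<epsilon>\<^sup>2" "C\<^sup>2 = 256 / sqrt \<epsilon>"
  proof -
    have "sqrt (sqrt \<epsilon>) \<le> 1" using \<epsilon> by simp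
    then have "sqrt (sqrt \<epsilon>) \<le> 16" by linarith
    then show "1 \<le> C" unfolding C_def using \<epsilon> by (simp add: field_simps)
    show "C\<^sup>2 = 256 / sqrt \<epsilon>" unfolding C_def using \<epsilon> by (simp add: power_divide)
    have "C ^ 8 = ((C\<^sup>2)\<^sup>2)\<^sup>2" by (simp flip: power_mult)
    then show "C ^ 8 = 2 ^ 32 / \<epsilon>\<^sup>2" unfolding \<open>C\<^sup>2 = 256 / sqrt \<epsilon>\<close> using \<epsilon> by (simp add: power_divide)
  qed
  have "\<exists>k\<in>{1..K}. v \<in> V \<longrightarrow> w v / 8 \<le> (1 / 2) ^ k \<and> (1 / 2) ^ k \<le> w v / 4" for v
  proof (cases "v \<in> V")
    case True
    have "w v \<le> 2" using member_le_sum[of v I w] True V w0 sumw finI by auto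
    moreover have "8 * (1 / 2) ^ K \<le> \<omega>"
      using K n \<epsilon> unfolding \<omega>_def by (simp add: field_simps power_one_over)
    ultimately show ?thesis using exists_dyadic_density[of "w v" K] True unfolding V_def by auto
  next
    case False
    have "128 * 1 * 1 \<le> 128 * real n * (1 / \<epsilon>\<^sup>2)" using n \<epsilon>
      by (intro mult_mono) (auto simp: field_simps power_le_one)
    then have "K \<noteq> 0" using K by (intro notI) simp
    \<comment> \<open>A light element may get any valid scale, since its term in the final sum is
      nonnegative.\<close>
    then show ?thesis using False by (intro bexI[of _ 1]) auto
  qed
  then obtain k where k: "\<And>v. k v \<in> {1..K}"
    "\<And>v. v \<in> V \<Longrightarrow> w v / 8 \<le> (1 / 2) ^ k v \<and> (1 / 2) ^ k v \<le> w v / 4" by metis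
  define G where "G v = w v * measure_pmf.expectation (random_subset n ((1 / 2) ^ k v)) (\<lambda>S. \<bar>gap P Q v S\<bar>)" for v
  have "\<epsilon>\<^sup>2 * sqrt \<epsilon> / 2 ^ 14 = 4 * sqrt \<epsilon> / 1024 * (\<epsilon>\<^sup>2 / 64)" by simp
  also have "\<dots> \<le> 4 / (1 + C)\<^sup>2 * (\<epsilon>\<^sup>2 / 64)"
  proof (rule mult_right_mono)
    have "(1 + C)\<^sup>2 \<le> (2 * C)\<^sup>2" using C by (intro power_mono) auto
    also have "\<dots> = 1024 / sqrt \<epsilon>" using C by (simp add: power_mult_distrib)
    finally show "4 * sqrt \<epsilon> / 1024 \<le> 4 / (1 + C)\<^sup>2" using \<epsilon> C by (simp add: field_simps)
  qed simp
  \<comment> \<open>The main term is at least \<open>3/128 * \<epsilon>\<^sup>2\<close>, the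
    truncation error at most \<open>1/128 * \<epsilon>\<^sup>2\<close>, which leaves
    \<open>1/64 * \<epsilon>\<^sup>2\<close>.\<close>
  also have "\<dots> \<le> 4 / (1 + C)\<^sup>2 * (\<Sum>v\<in>V. Z v / 16 - w v * fact 9 * exp 1 / C ^ 8)"
  proof (rule mult_left_mono)
    have "sum w V * (fact 9 * exp 1 / C ^ 8) \<le> 2 * (362880 * 3 / C ^ 8)"
    proof (intro mult_mono divide_right_mono)
      show "sum w V \<le> 2" using sum_mono2[OF finI V(1), of w] w0 sumw by simp
      show "fact 9 \<le> (362880::real)" by (simp add: fact_numeral)
      show "exp 1 \<le> (3::real)" by (rule exp_le)
    qed (use C in auto)
    also have "\<dots> \<le> \<epsilon>\<^sup>2 / 128" unfolding C by simp
    finally have "\<epsilon>\<^sup>2 / 64 \<le> sum Z V / 16 - sum w V * (fact 9 * exp 1 / C ^ 8)" using sumZV by simp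
    also have "\<dots> = (\<Sum>v\<in>V. Z v / 16 - w v * fact 9 * exp 1 / C ^ 8)"
      by (simp add: sum_subtractf sum_divide_distrib sum_distrib_right mult.assoc)
    finally show "\<epsilon>\<^sup>2 / 64 \<le> (\<Sum>v\<in>V. Z v / 16 - w v * fact 9 * exp 1 / C ^ 8)" .
  qed (use C in auto)
  also have "\<dots> = (\<Sum>v\<in>V. 4 / (1 + C)\<^sup>2 * (Z v / 16 - w v * fact 9 * exp 1 / C ^ 8))"
    by (rule sum_distrib_left)
  also have "\<dots> \<le> sum G V"
  proof (intro sum_mono)
    fix v assume v: "v \<in> V"
    then have vI: "v \<in> I" using V by blast
    have "0 < \<omega>" unfolding \<omega>_def using n \<epsilon> by simp
    then have "0 < w v" using v unfolding V_def by auto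
    then show "4 / (1 + C)\<^sup>2 * (Z v / 16 - w v * fact 9 * exp 1 / C ^ 8) \<le> G v"
      unfolding Z_def G_def w_def
      using PQ vI k(2)[OF v] L(1)[OF vI] L(2)[OF vI] L(3)[OF vI] C(1) unfolding w_def I_def
      by (intro expected_gap_lower_bound) simp_all
  qed
  also have "\<dots> \<le> sum G I" using V finI w0 unfolding G_def by (intro sum_mono2) auto
  finally show ?thesis using k(1) unfolding G_def I_def by (intro exI[of _ k]) simp
qed

section \<open>Comparing the two oracles on one set\<close>

lemma set_pmf_COND: "finite A \<Longrightarrow> A \<noteq> {} \<Longrightarrow> set_pmf (COND D A) \<subseteq> A"
proof
  fix x assume A: "finite A" "A \<noteq> {}" and x: "x \<in> set_pmf (COND D A)"
  show "x \<in> A"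
  proof (cases "measure_pmf.prob D A > 0")
    case True
    then show ?thesis using x by (auto simp: set_pmf_iff pmf_COND_pos split: if_splits)
  next
    case False
    then show ?thesis using x A by (simp add: COND_def)
  qed
qed

lemma answers_replicate:
  "answers P Q (replicate m A) = replicate_pmf m (pair_pmf (COND P A) (COND Q A))"
  by (induction m) (simp_all add: pair_pmf_def bind_assoc_pmf bind_return_pmf map_pmf_def)

section \<open>An exponential tail bound for independent samples, applied to the oracle
  answers\<close>

lemma finite_set_replicate_pmf:
  assumes "finite (set_pmf p)"
  shows "finite (set_pmf (replicate_pmf m p))"
proof -
  have "set_pmf (replicate_pmf m p) = {xs. set xs \<subseteq> set_pmf p \<and> length xs = m}"
    by (auto simp: set_replicate_pmf in_lists_conv_set)
  then show ?thesis using finite_lists_length_eq[OF assms] by simp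
qed

lemma expectation_replicate_pmf_prod_list:
  fixes f :: "'a \<Rightarrow> real"
  assumes fin: "finite (set_pmf p)"
  shows "measure_pmf.expectation (replicate_pmf m p) (\<lambda>xs. prod_list (map f xs))
    = measure_pmf.expectation p f ^ m"
proof (induction m)
  case (Suc m)
  have "measure_pmf.expectation (replicate_pmf (Suc m) p) (\<lambda>xs. prod_list (map f xs))
     = (\<Sum>x\<in>set_pmf p. pmf p x *\<^sub>R measure_pmf.expectation (map_pmf ((#) x) (replicate_pmf m p))
          (\<lambda>xs. prod_list (map f xs)))"
    unfolding replicate_pmf.simps map_pmf_def[symmetric]
    using fin by (intro pmf_expectation_bind) (auto simp: finite_set_replicate_pmf)
  also have "\<dots> = (\<Sum>x\<in>set_pmf p. f x * pmf p x) * measure_pmf.expectation p f ^ m"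
    unfolding sum_distrib_right by (intro sum.cong) (simp_all add: Suc)
  also have "(\<Sum>x\<in>set_pmf p. f x * pmf p x) = measure_pmf.expectation p f"
    using fin by (subst integral_measure_pmf_real[where A = "set_pmf p"]) auto
  finally show ?case by simp
qed simp

text \<open>Chernoff's method with \<open>exp t \<le> 1 + t + t\<^sup>2\<close> for \<open>t\<close>
  of absolute value at most 1. The parameter \<open>l = \<theta> / 2\<close> minimises the exponent
  \<open>m * (l\<^sup>2 - l * \<theta>)\<close>.\<close>

lemma replicate_pmf_sum_list_tail:
  fixes f :: "'a \<Rightarrow> real"
  assumes fin: "finite (set_pmf p)" and f: "\<And>x. \<bar>f x\<bar> \<le> 1"
    and \<mu>: "measure_pmf.expectation p f \<le> \<mu>" and \<theta>: "0 < \<theta>" "\<theta> \<le> 1"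
  shows "measure_pmf.prob (replicate_pmf m p) {xs. (\<mu> + \<theta>) * real m \<le> sum_list (map f xs)}
    \<le> exp (- real m * \<theta>\<^sup>2 / 4)"
proof -
  define l where "l = \<theta> / 2"
  have l: "0 < l" "l \<le> 1" unfolding l_def using \<theta> by auto
  have int: "integrable (measure_pmf p) g" for g :: "'a \<Rightarrow> real"
    by (rule integrable_measure_pmf_finite[OF fin])
  have exp_sum_list: "exp (l * sum_list (map f xs)) = prod_list (map (\<lambda>x. exp (l * f x)) xs)" for xs
    by (induction xs) (simp_all add: distrib_left exp_add)
  have "exp (l * f x) \<le> 1 + l * f x + l\<^sup>2" for x
  proof -
    have lf: "\<bar>l * f x\<bar> \<le> l" using l mult_left_mono[OF f[of x], of l] by (simp add: abs_mult)
    have "exp (l * f x) \<le> 1 + l * f x + (l * f x)\<^sup>2"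
    proof (cases "0 \<le> l * f x")
      case True
      moreover have "l * f x \<le> 1" using lf l by linarith
      ultimately show ?thesis by (intro exp_bound)
    next
      case False
      define y where "y = - (l * f x)"
      have y: "0 \<le> y" using False unfolding y_def by simp
      \<comment> \<open>For negative arguments, factor \<open>1 + y ^ 3\<close> and bound the factor
        \<open>1 + y\<close> by \<open>exp y\<close>.\<close>
      have "1 \<le> 1 + y ^ 3" using y by simp
      also have "\<dots> = (1 + y) * (1 - y + y\<^sup>2)" by (simp add: algebra_simps power2_eq_square power3_eq_cube)
      also have "\<dots> \<le> exp y * (1 - y + y\<^sup>2)"
      proof (intro mult_right_mono exp_ge_add_one_self)
        have "0 \<le> (1 - y)\<^sup>2" by simp
        then show "0 \<le> 1 - y + y\<^sup>2" using y by (simp add: power2_eq_square algebra_simps)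
      qed
      finally have "exp (- y) * 1 \<le> exp (- y) * (exp y * (1 - y + y\<^sup>2))" by (intro mult_left_mono) auto
      moreover have "exp (- y) * (exp y * t) = t" for t by (simp flip: mult.assoc exp_add)
      ultimately have "exp (- y) \<le> 1 - y + y\<^sup>2" by simp
      then show ?thesis unfolding y_def by simp
    qed
    also have "(l * f x)\<^sup>2 \<le> l\<^sup>2" using lf l by (simp flip: abs_le_square_iff)
    finally show ?thesis by simp
  qed
  then have "measure_pmf.expectation p (\<lambda>x. exp (l * f x))
      \<le> measure_pmf.expectation p (\<lambda>x. 1 + l * f x + l\<^sup>2)"
    by (intro integral_mono int)
  also have "\<dots> = 1 + l * measure_pmf.expectation p f + l\<^sup>2" by (simp add: int)
  also have "\<dots> \<le> 1 + (l * \<mu> + l\<^sup>2)" using l \<mu> by simp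
  also have "\<dots> \<le> exp (l * \<mu> + l\<^sup>2)" by (rule exp_ge_add_one_self)
  finally have mgf: "measure_pmf.expectation p (\<lambda>x. exp (l * f x)) \<le> exp (l * \<mu> + l\<^sup>2)" .

  let ?R = "replicate_pmf m p"
  have intR: "integrable (measure_pmf ?R) g" for g :: "'a list \<Rightarrow> real"
    using finite_set_replicate_pmf[OF fin] by (rule integrable_measure_pmf_finite)
  have "measure_pmf.prob ?R {xs. (\<mu> + \<theta>) * real m \<le> sum_list (map f xs)}
      = measure_pmf.expectation ?R (indicator {xs. (\<mu> + \<theta>) * real m \<le> sum_list (map f xs)})"
    by simp
  also have "\<dots> \<le> measure_pmf.expectation ?R
      (\<lambda>xs. exp (l * sum_list (map f xs)) * exp (- l * ((\<mu> + \<theta>) * real m)))"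
    using l by (intro integral_mono intR) (auto simp: indicator_def simp flip: exp_add right_diff_distrib)
  also have "\<dots> = measure_pmf.expectation p (\<lambda>x. exp (l * f x)) ^ m * exp (- l * ((\<mu> + \<theta>) * real m))"
    unfolding exp_sum_list by (simp add: expectation_replicate_pmf_prod_list fin)
  also have "\<dots> \<le> exp (l * \<mu> + l\<^sup>2) ^ m * exp (- l * ((\<mu> + \<theta>) * real m))"
    by (intro mult_right_mono power_mono mgf) auto
  also have "\<dots> = exp (real m * (l * \<mu> + l\<^sup>2) + - l * ((\<mu> + \<theta>) * real m))"
    by (simp only: exp_of_nat_mult exp_add)
  also have "real m * (l * \<mu> + l\<^sup>2) + - l * ((\<mu> + \<theta>) * real m) = - real m * \<theta>\<^sup>2 / 4"
    unfolding l_def by (simp add: algebra_simps power2_eq_square)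
  finally show ?thesis .
qed

text \<open>The empirical counterpart of \<open>gap\<close>: on \<open>m\<close> answer pairs for
  \<open>insert v S\<close> its expectation is \<open>m * gap P Q v S\<close>.\<close>

definition excess :: "nat \<Rightarrow> (nat \<times> nat) list \<Rightarrow> real" where
  "excess v as = (\<Sum>(a, b)\<leftarrow>as. of_bool (a = v) - of_bool (b = v))"

definition balanced :: "real \<Rightarrow> nat \<Rightarrow> (nat \<times> nat) list \<Rightarrow> bool" where
  "balanced \<theta> v as \<longleftrightarrow> \<bar>excess v as\<bar> < \<theta> * real (length as)"

text \<open>The sign \<open>s\<close> lets one statement serve both tails; the summand for one
  answer pair has mean \<open>s * gap P Q v S\<close>.\<close>

lemma excess_tail:
  assumes S: "finite S" and \<theta>: "0 < \<theta>" "\<theta> \<le> 1" and s: "\<bar>s\<bar> = (1 :: real)" and \<mu>: "s * gap P Q v S \<le> \<mu>"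
  shows "measure_pmf.prob (answers P Q (replicate m (insert v S)))
     {as. (\<mu> + \<theta>) * real m \<le> s * excess v as} \<le> exp (- real m * \<theta>\<^sup>2 / 4)"
proof -
  let ?A = "insert v S"
  let ?p = "pair_pmf (COND P ?A) (COND Q ?A)"
  define f :: "nat \<times> nat \<Rightarrow> real" where "f = (\<lambda>(a, b). s * (of_bool (a = v) - of_bool (b = v)))"
  have fin: "finite (set_pmf (COND D ?A))" for D
    using set_pmf_COND[of ?A] S finite_subset by blast
  have int: "integrable (measure_pmf ?p) g" for g :: "nat \<times> nat \<Rightarrow> real"
    using fin by (intro integrable_measure_pmf_finite) simp
  have sl: "sum_list (map f as) = s * excess v as" for as
    unfolding f_def excess_def sum_list_const_mult[symmetric] by (simp add: case_prod_beta')
  have point: "measure_pmf.expectation D (\<lambda>a. of_bool (a = v) :: real) = pmf D v" for D :: "nat pmf"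
  proof -
    have "(\<lambda>a. of_bool (a = v) :: real) = indicator {v}" by (auto simp: indicator_def)
    then show ?thesis by (simp add: measure_pmf_single)
  qed
  have "measure_pmf.expectation ?p f
      = s * (measure_pmf.expectation ?p (\<lambda>x. of_bool (fst x = v)) - measure_pmf.expectation ?p (\<lambda>x. of_bool (snd x = v)))"
    unfolding f_def case_prod_beta' by (simp add: int)
  also have "measure_pmf.expectation ?p (\<lambda>x. of_bool (fst x = v) :: real)
      = measure_pmf.expectation (map_pmf fst ?p) (\<lambda>a. of_bool (a = v))" by simp
  also have "measure_pmf.expectation ?p (\<lambda>x. of_bool (snd x = v) :: real)
      = measure_pmf.expectation (map_pmf snd ?p) (\<lambda>a. of_bool (a = v))" by simp
  finally have "measure_pmf.expectation ?p f = s * gap P Q v S"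
    unfolding map_fst_pair_pmf map_snd_pair_pmf point gap_def .
  then have "measure_pmf.prob (replicate_pmf m ?p) {xs. (\<mu> + \<theta>) * real m \<le> sum_list (map f xs)}
    \<le> exp (- real m * \<theta>\<^sup>2 / 4)"
    using \<mu> \<theta> fin s by (intro replicate_pmf_sum_list_tail) (auto simp: f_def abs_mult)
  then show ?thesis unfolding answers_replicate sl .
qed

lemma set_pmf_answers_length: "as \<in> set_pmf (answers P Q Ss) \<Longrightarrow> length as = length Ss"
  by (induction Ss arbitrary: as) auto

lemma prob_unbalanced_equal:
  assumes S: "finite S" and \<theta>: "0 < \<theta>" "\<theta> \<le> 1"
  shows "measure_pmf.prob (answers P P (replicate m (insert v S))) {as. \<not> balanced \<theta> v as}
    \<le> 2 * exp (- real m * \<theta>\<^sup>2 / 4)"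
proof -
  let ?D = "answers P P (replicate m (insert v S))"
  have g: "gap P P v S = 0" unfolding gap_def by simp
  have "measure_pmf.prob ?D {as. \<not> balanced \<theta> v as}
     \<le> measure_pmf.prob ?D ({as. (0 + \<theta>) * real m \<le> 1 * excess v as} \<union> {as. (0 + \<theta>) * real m \<le> - 1 * excess v as})"
    by (intro measure_pmf.finite_measure_mono_AE AE_pmfI)
       (auto simp: balanced_def dest!: set_pmf_answers_length)
  also have "\<dots> \<le> measure_pmf.prob ?D {as. (0 + \<theta>) * real m \<le> 1 * excess v as}
      + measure_pmf.prob ?D {as. (0 + \<theta>) * real m \<le> - 1 * excess v as}"
    by (rule measure_Un_le) auto
  also have "\<dots> \<le> exp (- real m * \<theta>\<^sup>2 / 4) + exp (- real m * \<theta>\<^sup>2 / 4)"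
    by (intro add_mono excess_tail S \<theta>) (simp_all add: g)
  finally show ?thesis by simp
qed

text \<open>Choosing \<open>s\<close> opposite to the sign of the gap gives mean at most
  \<open>- 2 * \<theta>\<close>, whereas balanced answers keep the signed average above
  \<open>- \<theta>\<close>.\<close>

lemma prob_balanced_far:
  assumes S: "finite S" and \<theta>: "0 < \<theta>" "\<theta> \<le> 1" and far: "2 * \<theta> \<le> \<bar>gap P Q v S\<bar>"
  shows "measure_pmf.prob (answers P Q (replicate m (insert v S))) {as. balanced \<theta> v as}
    \<le> exp (- real m * \<theta>\<^sup>2 / 4)"
proof -
  let ?D = "answers P Q (replicate m (insert v S))"
  define s where "s = - sgn (gap P Q v S)"
  have s: "\<bar>s\<bar> = 1" "s * gap P Q v S \<le> - (2 * \<theta>)"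
    unfolding s_def using far \<theta> by (auto simp: sgn_if)
  have "measure_pmf.prob ?D {as. balanced \<theta> v as}
     \<le> measure_pmf.prob ?D {as. (- (2 * \<theta>) + \<theta>) * real m \<le> s * excess v as}"
  proof (intro measure_pmf.finite_measure_mono_AE AE_pmfI)
    fix as assume as: "as \<in> set_pmf ?D"
    show "as \<in> {as. balanced \<theta> v as} \<longrightarrow> as \<in> {as. (- (2 * \<theta>) + \<theta>) * real m \<le> s * excess v as}"
    proof
      assume "as \<in> {as. balanced \<theta> v as}"
      then have "\<bar>s * excess v as\<bar> < \<theta> * real m"
        using set_pmf_answers_length[OF as] s(1) by (simp add: balanced_def abs_mult)
      then show "as \<in> {as. (- (2 * \<theta>) + \<theta>) * real m \<le> s * excess v as}" by (simp add: algebra_simps abs_less_iff)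
    qed
  qed auto
  also have "\<dots> \<le> exp (- real m * \<theta>\<^sup>2 / 4)" by (rule excess_tail[OF S \<theta> s])
  finally show ?thesis .
qed

section \<open>The tester\<close>

lemma answers_append:
  "answers P Q (Ss @ Ts) = bind_pmf (answers P Q Ss) (\<lambda>as. map_pmf (\<lambda>bs. as @ bs) (answers P Q Ts))"
proof -
  have "(@) [] = (\<lambda>bs :: (nat \<times> nat) list. bs)" and "(@) (x # xs) = (\<lambda>bs. x # xs @ bs)" for x :: "nat \<times> nat" and xs
    by auto
  then show ?thesis
    by (induction Ss) (simp_all add: pmf.map_ident bind_return_pmf bind_assoc_pmf map_bind_pmf bind_map_pmf pmf.map_comp o_def)
qed

text \<open>This turns the first round, which queries the whole domain, into plain sampling from
  both distributions.\<close>

lemma COND_full: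
  assumes "dist_on n P"
  shows "COND P {1..n} = P"
proof (rule pmf_eqI)
  fix x
  have 1: "measure_pmf.prob P {1..n} = 1"
    using assms unfolding dist_on_def by (intro measure_pmf.prob_eq_1[THEN iffD2]) (auto simp: AE_measure_pmf_iff)
  have "x \<notin> {1..n} \<Longrightarrow> pmf P x = 0" using assms unfolding dist_on_def by (auto simp: set_pmf_iff)
  then show "pmf (COND P {1..n}) x = pmf P x" using 1 by (simp add: pmf_COND_pos)
qed

lemma pmf_bind_le:
  assumes "\<And>y. y \<in> set_pmf p \<Longrightarrow> pmf (f y) x \<le> c"
  shows "pmf (bind_pmf p f) x \<le> c"
proof -
  have "pmf (bind_pmf p f) x \<le> measure_pmf.expectation p (\<lambda>_. c)"
    unfolding pmf_bind using assms
    by (intro integral_mono_AE AE_pmfI) (auto simp: pmf_le_1 intro!: measure_pmf.integrable_const_bound[where B = 1])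
  then show ?thesis by simp
qed

lemma pmf_bind_finite:
  assumes "finite A" "set_pmf p \<subseteq> A"
  shows "pmf (bind_pmf p f) x = (\<Sum>a\<in>A. pmf p a * pmf (f a) x)"
  unfolding pmf_bind using assms by (subst integral_measure_pmf_real[of A]) (auto simp: mult.commute)

section \<open>Construction of the tester and its decomposition into trials\<close>

definition candidate :: "bool \<Rightarrow> nat \<times> nat \<Rightarrow> nat" where
  "candidate c a = (if c then fst a else snd a)"

fun second_round :: "nat \<Rightarrow> (bool \<times> nat set) list \<Rightarrow> (nat \<times> nat) list \<Rightarrow> nat set list" where
  "second_round m ((c, S) # R) (a # as) = replicate m (insert (candidate c a) S) @ second_round m R as"
| "second_round m _ _ = []"

text \<open>The second-round answers arrive as one flat list, with \<open>m\<close> consecutive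
  pairs for each trial; \<open>take\<close> and \<open>drop\<close> cut it along the blocks laid out
  by \<open>second_round\<close>. The catch-all clause is the empty conjunction.\<close>

fun all_balanced :: "real \<Rightarrow> nat \<Rightarrow> (bool \<times> nat set) list \<Rightarrow> (nat \<times> nat) list \<Rightarrow> (nat \<times> nat) list \<Rightarrow> bool" where
  "all_balanced \<theta> m ((c, S) # R) (a # as) bs \<longleftrightarrow>
     balanced \<theta> (candidate c a) (take m bs) \<and> all_balanced \<theta> m R as (drop m bs)"
| "all_balanced \<theta> m _ _ _ \<longleftrightarrow> True"

definition random_set :: "nat \<Rightarrow> nat \<Rightarrow> nat set pmf" where
  "random_set n K = bind_pmf (pmf_of_set {1..K}) (\<lambda>k. random_subset n ((1 / 2) ^ k))"

text \<open>All coins and random sets are drawn in advance, so that each outcome is a deterministic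
  tester. Only the pivots inserted into the sets depend on the first-round answers. The fair coin
  gives each pivot the law \<open>(P + Q) / 2\<close>.\<close>

definition gap_tester :: "nat \<Rightarrow> nat \<Rightarrow> nat \<Rightarrow> real \<Rightarrow> nat \<Rightarrow> tester" where
  "gap_tester n N m \<theta> K = map_pmf
     (\<lambda>R. \<lparr>first_sets = replicate (length R) {1..n}, second_sets = second_round m R,
        decision = (\<lambda>as bs. if all_balanced \<theta> m R as bs then Accept else Reject)\<rparr>)
     (replicate_pmf N (pair_pmf (bernoulli_pmf (1 / 2)) (random_set n K)))"

definition check :: "nat pmf \<Rightarrow> nat pmf \<Rightarrow> nat \<Rightarrow> real \<Rightarrow> nat \<Rightarrow> nat set \<Rightarrow> bool pmf" where
  "check P Q m \<theta> v S = map_pmf (balanced \<theta> v) (answers P Q (replicate m (insert v S)))"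

definition trial :: "nat pmf \<Rightarrow> nat pmf \<Rightarrow> nat \<Rightarrow> nat \<Rightarrow> real \<Rightarrow> bool \<times> nat set \<Rightarrow> bool pmf" where
  "trial P Q n m \<theta> = (\<lambda>(c, S). bind_pmf (COND P {1..n}) (\<lambda>i. bind_pmf (COND Q {1..n}) (\<lambda>j.
     check P Q m \<theta> (candidate c (i, j)) S)))"

definition trials :: "nat pmf \<Rightarrow> nat pmf \<Rightarrow> nat \<Rightarrow> nat \<Rightarrow> real \<Rightarrow> (bool \<times> nat set) list \<Rightarrow> bool pmf" where
  "trials P Q n m \<theta> R = bind_pmf (answers P Q (replicate (length R) {1..n})) (\<lambda>as.
     map_pmf (all_balanced \<theta> m R as) (answers P Q (second_round m R as)))"

text \<open>The tester asks all first-round queries before any second-round query. Answers are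
  independent, so the second-round block of the first trial can be moved ahead of the first-round
  answers of the others, which isolates one complete trial.\<close>

lemma trials_Cons:
  "trials P Q n m \<theta> (x # R) = bind_pmf (trial P Q n m \<theta> x) (\<lambda>b. map_pmf ((\<and>) b) (trials P Q n m \<theta> R))"
proof -
  obtain c S where x: "x = (c, S)" by (cases x)
  let ?first = "answers P Q (replicate (length R) {1..n})"
  have split: "map_pmf (all_balanced \<theta> m (x # R) (a # as)) (answers P Q (second_round m (x # R) (a # as)))
     = bind_pmf (answers P Q (replicate m (insert (candidate c a) S))) (\<lambda>bs.
         map_pmf (\<lambda>cs. balanced \<theta> (candidate c a) bs \<and> all_balanced \<theta> m R as cs) (answers P Q (second_round m R as)))"
    for a as
    unfolding x second_round.simps answers_append map_bind_pmf pmf.map_comp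
    by (intro bind_pmf_cong refl pmf.map_cong) (auto dest!: set_pmf_answers_length)
  have "trials P Q n m \<theta> (x # R) = bind_pmf (COND P {1..n}) (\<lambda>i. bind_pmf (COND Q {1..n}) (\<lambda>j.
     bind_pmf ?first (\<lambda>as. bind_pmf (answers P Q (replicate m (insert (candidate c (i, j)) S))) (\<lambda>bs.
         map_pmf (\<lambda>cs. balanced \<theta> (candidate c (i, j)) bs \<and> all_balanced \<theta> m R as cs)
           (answers P Q (second_round m R as))))))"
    unfolding trials_def split[symmetric] by (simp add: bind_assoc_pmf bind_map_pmf)
  also have "\<dots> = bind_pmf (COND P {1..n}) (\<lambda>i. bind_pmf (COND Q {1..n}) (\<lambda>j.
     bind_pmf (answers P Q (replicate m (insert (candidate c (i, j)) S))) (\<lambda>bs. bind_pmf ?first (\<lambda>as.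
         map_pmf (\<lambda>cs. balanced \<theta> (candidate c (i, j)) bs \<and> all_balanced \<theta> m R as cs)
           (answers P Q (second_round m R as))))))"
    by (rule bind_pmf_cong[OF refl], rule bind_pmf_cong[OF refl], rule bind_commute_pmf)
  also have "\<dots> = bind_pmf (trial P Q n m \<theta> x) (\<lambda>b. map_pmf ((\<and>) b) (trials P Q n m \<theta> R))"
    unfolding trial_def trials_def check_def x
    by (simp add: bind_assoc_pmf bind_map_pmf map_bind_pmf pmf.map_comp o_def)
  finally show ?thesis .
qed

lemma pmf_conj_bind: "pmf (bind_pmf p (\<lambda>b. map_pmf ((\<and>) b) q)) True = pmf p True * pmf q True"
proof -
  have "pmf (map_pmf ((\<and>) True) q) True = pmf q True"
  proof -
    have "(\<and>) True = (\<lambda>b. b)" by auto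
    then show ?thesis by (simp only: pmf.map_ident)
  qed
  moreover have "pmf (map_pmf ((\<and>) False) q) True = 0" by (simp add: pmf_eq_0_set_pmf)
  ultimately show ?thesis by (subst pmf_bind_finite[of UNIV]) (auto simp: UNIV_bool)
qed

text \<open>The trials use independent coins, sets and answers, and the tester accepts only if all
  succeed; the probability is therefore a power.\<close>

lemma pmf_replicate_trials:
  "pmf (bind_pmf (replicate_pmf N \<rho>) (trials P Q n m \<theta>)) True = pmf (bind_pmf \<rho> (trial P Q n m \<theta>)) True ^ N"
proof (induction N)
  case 0
  have "trials P Q n m \<theta> [] = return_pmf True" by (simp add: trials_def bind_return_pmf)
  then show ?case by (simp add: bind_return_pmf)
next
  case (Suc N)
  let ?G = "\<lambda>N. bind_pmf (replicate_pmf N \<rho>) (trials P Q n m \<theta>)"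
  have "?G (Suc N) = bind_pmf \<rho> (\<lambda>x. bind_pmf (replicate_pmf N \<rho>) (\<lambda>R.
      bind_pmf (trial P Q n m \<theta> x) (\<lambda>b. map_pmf ((\<and>) b) (trials P Q n m \<theta> R))))"
    by (simp add: bind_assoc_pmf bind_return_pmf trials_Cons)
  also have "\<dots> = bind_pmf \<rho> (\<lambda>x. bind_pmf (trial P Q n m \<theta> x) (\<lambda>b. bind_pmf (replicate_pmf N \<rho>) (\<lambda>R.
      map_pmf ((\<and>) b) (trials P Q n m \<theta> R))))"
    by (rule bind_pmf_cong[OF refl], rule bind_commute_pmf)
  also have "\<dots> = bind_pmf (bind_pmf \<rho> (trial P Q n m \<theta>)) (\<lambda>b. map_pmf ((\<and>) b) (?G N))"
    by (simp add: bind_assoc_pmf map_bind_pmf)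
  finally show ?case using Suc by (simp add: pmf_conj_bind)
qed

section \<open>Acceptance probability and admissibility of the query sets\<close>

lemma pmf_verdict_sum: "pmf D Accept + pmf D Reject = 1"
proof -
  have "set_pmf D \<subseteq> {Accept, Reject}" using verdict.exhaust by blast
  then show ?thesis using sum_pmf_eq_1[of "{Accept, Reject}" D] by simp
qed

lemma pmf_bool_sum: "pmf p True + pmf p False = 1"
proof -
  have "set_pmf p \<subseteq> {True, False}" by auto
  then show ?thesis using sum_pmf_eq_1[of "{True, False}" p] by simp
qed

lemma pmf_run_gap_tester_Accept:
  "pmf (run (gap_tester n N m \<theta> K) P Q) Accept
   = pmf (bind_pmf (pair_pmf (bernoulli_pmf (1 / 2)) (random_set n K)) (trial P Q n m \<theta>)) True ^ N"
proof -
  let ?verdict = "\<lambda>b. if b then Accept else Reject"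
  have "run (gap_tester n N m \<theta> K) P Q = map_pmf ?verdict
     (bind_pmf (replicate_pmf N (pair_pmf (bernoulli_pmf (1 / 2)) (random_set n K))) (trials P Q n m \<theta>))"
    unfolding run_def gap_tester_def trials_def
    by (simp add: bind_map_pmf map_bind_pmf pmf.map_comp o_def)
  moreover have "inj ?verdict" by (auto simp: inj_def split: if_splits)
  then have "pmf (map_pmf ?verdict p) (?verdict True) = pmf p True" for p by (rule pmf_map_inj')
  ultimately show ?thesis by (simp add: pmf_replicate_trials)
qed

text \<open>Each second-round set contains its candidate, which lies in the domain because it is a
  possible first-round answer; so no empty set is queried.\<close>

lemma one_round_adaptive_gap_tester:
  assumes "1 \<le> n" "1 \<le> K"
  shows "one_round_adaptive n N (N * m) (gap_tester n N m \<theta> K)"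
proof -
  have "query_sets n (length R * m) (second_round m R as)"
    if "set R \<subseteq> UNIV \<times> Pow {1..n}" "list_all2 (\<lambda>S (i, j). i \<in> S \<and> j \<in> S) (replicate (length R) {1..n}) as" for R as
    using that
  proof (induction R arbitrary: as)
    case (Cons x R)
    then obtain a as' where as: "as = a # as'" "fst a \<in> {1..n}" "snd a \<in> {1..n}"
        "list_all2 (\<lambda>S (i, j). i \<in> S \<and> j \<in> S) (replicate (length R) {1..n}) as'"
      by (cases as) (auto simp: case_prod_beta')
    then have "query_sets n (length R * m) (second_round m R as')" using Cons by simp
    then show ?case using Cons.prems as by (cases x) (auto simp: query_sets_def candidate_def)
  qed (simp add: query_sets_def)
  moreover have "set_pmf (random_set n K) \<subseteq> Pow {1..n}"
    using set_pmf_random_subset unfolding random_set_def by (auto simp: set_bind_pmf)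
  then have "length R = N \<and> set R \<subseteq> UNIV \<times> Pow {1..n}"
    if "R \<in> set_pmf (replicate_pmf N (pair_pmf (bernoulli_pmf (1 / 2)) (random_set n K)))" for R
    using that by (fastforce simp: set_replicate_pmf in_lists_conv_set)
  moreover have "query_sets n N (replicate N {1..n})"
    using assms by (simp add: query_sets_def)
  ultimately show ?thesis unfolding one_round_adaptive_def gap_tester_def by fastforce
qed

section \<open>Rejection probability of a single trial\<close>

lemma pmf_check_False:
  "pmf (check P Q m \<theta> v S) False
    = measure_pmf.prob (answers P Q (replicate m (insert v S))) {as. \<not> balanced \<theta> v as}"
  unfolding check_def pmf_map by (intro arg_cong2[where f = measure_pmf.prob] refl) auto

text \<open>A gap of at least \<open>2 * \<theta>\<close> is detected with probability at least one
  half, and no gap exceeds 1; for a smaller gap the left side is not positive. A bound linear in the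
  absolute gap can be averaged over the random set.\<close>

lemma pmf_check_False_ge:
  assumes "finite S" "0 < \<theta>" "\<theta> \<le> 1" "exp (- real m * \<theta>\<^sup>2 / 4) \<le> 1 / 2"
  shows "(\<bar>gap P Q v S\<bar> - 2 * \<theta>) / 2 \<le> pmf (check P Q m \<theta> v S) False"
proof (cases "2 * \<theta> \<le> \<bar>gap P Q v S\<bar>")
  case True
  let ?D = "answers P Q (replicate m (insert v S))"
  have "measure_pmf.prob ?D {as. \<not> balanced \<theta> v as} = 1 - measure_pmf.prob ?D {as. balanced \<theta> v as}"
    using measure_pmf.prob_compl[of "{as. balanced \<theta> v as}" ?D] by (simp add: Compl_eq_Diff_UNIV[symmetric] Collect_neg_eq)
  then have "1 / 2 \<le> pmf (check P Q m \<theta> v S) False"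
    using prob_balanced_far[of S \<theta> P Q v m] assms True unfolding pmf_check_False by linarith
  moreover have "\<bar>gap P Q v S\<bar> \<le> 1"
    unfolding gap_def using pmf_le_1 pmf_nonneg by (smt (verit))
  ultimately show ?thesis using assms by simp
next
  case False
  then have "(\<bar>gap P Q v S\<bar> - 2 * \<theta>) / 2 \<le> 0" by simp
  then show ?thesis by (rule order.trans) (rule pmf_nonneg)
qed

lemma pmf_trial_False_equal:
  assumes "0 < \<theta>" "\<theta> \<le> 1"
  shows "pmf (bind_pmf (pair_pmf \<beta> (random_set n K)) (trial P P n m \<theta>)) False
    \<le> 2 * exp (- real m * \<theta>\<^sup>2 / 4)"
proof (rule pmf_bind_le)
  fix y assume y: "y \<in> set_pmf (pair_pmf \<beta> (random_set n K))"
  obtain c S where cS: "y = (c, S)" by (cases y)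
  have "S \<subseteq> {1..n}" using y set_pmf_random_subset unfolding cS random_set_def by (auto simp: set_bind_pmf)
  then have "finite S" using finite_subset by blast
  then show "pmf (trial P P n m \<theta> y) False \<le> 2 * exp (- real m * \<theta>\<^sup>2 / 4)"
    unfolding cS trial_def prod.case
    by (intro pmf_bind_le) (unfold pmf_check_False, rule prob_unbalanced_equal[OF _ assms])
qed

text \<open>The sample not selected by the coin is discarded, and the pivot can be drawn before the
  independent set. This makes the law of the pivot explicit.\<close>

lemma bind_trial_eq:
  assumes "dist_on n P" "dist_on n Q"
  shows "bind_pmf (pair_pmf \<beta> \<rho>) (trial P Q n m \<theta>)
    = bind_pmf \<beta> (\<lambda>c. bind_pmf (if c then P else Q) (\<lambda>v. bind_pmf \<rho> (check P Q m \<theta> v)))"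
proof -
  have "bind_pmf (pair_pmf \<beta> \<rho>) (trial P Q n m \<theta>) = bind_pmf \<beta> (\<lambda>c. bind_pmf \<rho> (\<lambda>S.
      bind_pmf P (\<lambda>i. bind_pmf Q (\<lambda>j. check P Q m \<theta> (candidate c (i, j)) S))))"
    unfolding trial_def COND_full[OF assms(1)] COND_full[OF assms(2)]
    by (simp add: pair_pmf_def bind_assoc_pmf bind_return_pmf)
  also have "\<dots> = bind_pmf \<beta> (\<lambda>c. bind_pmf \<rho> (\<lambda>S. bind_pmf (if c then P else Q) (\<lambda>v. check P Q m \<theta> v S)))"
  proof (rule bind_pmf_cong[OF refl], rule bind_pmf_cong[OF refl])
    fix c S
    show "bind_pmf P (\<lambda>i. bind_pmf Q (\<lambda>j. check P Q m \<theta> (candidate c (i, j)) S))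
        = bind_pmf (if c then P else Q) (\<lambda>v. check P Q m \<theta> v S)"
      by (cases c) (simp_all add: candidate_def)
  qed
  also have "\<dots> = bind_pmf \<beta> (\<lambda>c. bind_pmf (if c then P else Q) (\<lambda>v. bind_pmf \<rho> (check P Q m \<theta> v)))"
    by (rule bind_pmf_cong[OF refl], rule bind_commute_pmf)
  finally show ?thesis .
qed

lemma pmf_trial_False_far:
  assumes PQ: "dist_on n P" "dist_on n Q" and \<theta>: "0 < \<theta>" "\<theta> \<le> 1" "exp (- real m * \<theta>\<^sup>2 / 4) \<le> 1 / 2"
    and k: "\<And>v. v \<in> {1..n} \<Longrightarrow> k v \<in> {1..K}"
    and gap: "8 * \<theta> \<le> (\<Sum>v\<in>{1..n}. (pmf P v + pmf Q v) *
        measure_pmf.expectation (random_subset n ((1 / 2) ^ k v)) (\<lambda>S. \<bar>gap P Q v S\<bar>))"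
  shows "\<theta> / real K \<le> pmf (bind_pmf (pair_pmf (bernoulli_pmf (1 / 2)) (random_set n K)) (trial P Q n m \<theta>)) False"
proof -
  define \<Psi> where "\<Psi> v = pmf (bind_pmf (random_set n K) (check P Q m \<theta> v)) False" for v
  define E where "E v = measure_pmf.expectation (random_subset n ((1 / 2) ^ k v)) (\<lambda>S. \<bar>gap P Q v S\<bar>)" for v
  define w where "w v = pmf P v + pmf Q v" for v
  have \<Psi>: "(E v - 2 * \<theta>) / (2 * real K) \<le> \<Psi> v" if v: "v \<in> {1..n}" for v
  proof -
    let ?c = "\<lambda>k. pmf (bind_pmf (random_subset n ((1 / 2) ^ k)) (check P Q m \<theta> v)) False"
    have ne: "{1..K} \<noteq> {}" using k[OF v] by auto
    have int: "integrable (random_subset n r) f" for f :: "nat set \<Rightarrow> real" and r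
      by (rule integrable_measure_pmf_finite) simp
    have "(E v - 2 * \<theta>) / 2 = measure_pmf.expectation (random_subset n ((1 / 2) ^ k v)) (\<lambda>S. (\<bar>gap P Q v S\<bar> - 2 * \<theta>) / 2)"
      unfolding E_def by (simp add: int)
    also have "\<dots> \<le> ?c (k v)"
      unfolding pmf_bind
    proof (intro integral_mono_AE int AE_pmfI)
      fix S assume "S \<in> set_pmf (random_subset n ((1 / 2) ^ k v))"
      then have "S \<subseteq> {1..n}" using set_pmf_random_subset by blast
      then have "finite S" using finite_subset by blast
      then show "(\<bar>gap P Q v S\<bar> - 2 * \<theta>) / 2 \<le> pmf (check P Q m \<theta> v S) False"
        using \<theta> by (rule pmf_check_False_ge)
    qed
    \<comment> \<open>Only the good scale \<open>k v\<close> is retained; a uniformly random scale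
      hits it with probability \<open>1 / K\<close>.\<close>
    also have "\<dots> \<le> (\<Sum>k\<in>{1..K}. ?c k)" using k[OF v] by (intro member_le_sum) auto
    finally have "(E v - 2 * \<theta>) / 2 / real K \<le> (\<Sum>k\<in>{1..K}. ?c k) / real K"
      by (rule divide_right_mono) simp
    also have "\<dots> = \<Psi> v"
      unfolding \<Psi>_def random_set_def bind_assoc_pmf
      using ne by (subst pmf_bind) (simp add: integral_pmf_of_set)
    finally show ?thesis by simp
  qed
  have K: "1 \<le> K"
  proof (rule ccontr)
    assume "\<not> 1 \<le> K"
    then have "{1..n} = {}" using k by (metis atLeastatMost_empty equals0D equals0I not_le)
    then show False using gap \<theta> by simp
  qed
  have "8 * \<theta> \<le> (\<Sum>v\<in>{1..n}. w v * E v)" using gap unfolding w_def E_def .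
  moreover have "(\<Sum>v\<in>{1..n}. w v) = 2"
    unfolding w_def by (simp only: sum.distrib sum_pmf_dist_on[OF PQ(1)] sum_pmf_dist_on[OF PQ(2)] one_add_one)
  \<comment> \<open>The slack \<open>2 * \<theta>\<close> is charged at total weight 2 and uses up
    half of \<open>8 * \<theta>\<close>. The later factor \<open>1 / (4 * K)\<close> combines the
    fair coin, the factor one half of the check and the choice of the scale.\<close>
  ultimately have "4 * \<theta> \<le> (\<Sum>v\<in>{1..n}. w v * (E v - 2 * \<theta>))"
    by (simp only: right_diff_distrib sum_subtractf sum_distrib_right[symmetric])
  then have "4 * \<theta> / (4 * real K) \<le> (\<Sum>v\<in>{1..n}. w v * (E v - 2 * \<theta>)) / (4 * real K)"
    by (rule divide_right_mono) simp
  also have "\<dots> = 1 / 2 * (\<Sum>v\<in>{1..n}. w v * ((E v - 2 * \<theta>) / (2 * real K)))"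
    by (simp add: sum_divide_distrib sum_distrib_left)
  also have "\<dots> \<le> 1 / 2 * (\<Sum>v\<in>{1..n}. w v * \<Psi> v)"
    by (intro mult_left_mono sum_mono \<Psi>) (auto simp: w_def)
  also have "\<dots> = 1 / 2 * (\<Sum>v\<in>{1..n}. pmf P v * \<Psi> v) + 1 / 2 * (\<Sum>v\<in>{1..n}. pmf Q v * \<Psi> v)"
    by (simp add: w_def distrib_right sum.distrib)
  also have "(\<Sum>v\<in>{1..n}. pmf P v * \<Psi> v)
      = pmf (bind_pmf P (\<lambda>v. bind_pmf (random_set n K) (check P Q m \<theta> v))) False"
    unfolding \<Psi>_def using PQ by (intro pmf_bind_finite[symmetric]) (auto simp: dist_on_def)
  also have "(\<Sum>v\<in>{1..n}. pmf Q v * \<Psi> v)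
      = pmf (bind_pmf Q (\<lambda>v. bind_pmf (random_set n K) (check P Q m \<theta> v))) False"
    unfolding \<Psi>_def using PQ by (intro pmf_bind_finite[symmetric]) (auto simp: dist_on_def)
  also have "1 / 2 * pmf (bind_pmf P (\<lambda>v. bind_pmf (random_set n K) (check P Q m \<theta> v))) False
      + 1 / 2 * pmf (bind_pmf Q (\<lambda>v. bind_pmf (random_set n K) (check P Q m \<theta> v))) False
      = pmf (bind_pmf (pair_pmf (bernoulli_pmf (1 / 2)) (random_set n K)) (trial P Q n m \<theta>)) False"
    unfolding bind_trial_eq[OF PQ] by (subst pmf_bind_finite[of UNIV]) (auto simp: UNIV_bool)
  finally show ?thesis using K by simp
qed

text \<open>The threshold \<open>\<theta>\<close> is one eighth of the guaranteed average gap. For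
  equal distributions each trial rejects with probability at most \<open>1 / (3 * N)\<close>, so all
  pass with probability at least 2/3. For far ones each rejects with probability at least
  \<open>\<theta> / K\<close>, and \<open>N\<close> trials all pass with probability at most
  \<open>exp (- 2)\<close>.\<close>

lemma equivalence_tester_gap_tester:
  fixes \<epsilon> :: real
  defines "\<theta> \<equiv> \<epsilon>\<^sup>2 * sqrt \<epsilon> / 2 ^ 17"
  assumes \<epsilon>: "0 < \<epsilon>" "\<epsilon> \<le> 1" and n: "1 \<le> n" and K: "128 * real n / \<epsilon>\<^sup>2 \<le> 2 ^ K"
    and N: "1 \<le> N" "2 * real K / \<theta> \<le> real N" and m: "exp (- real m * \<theta>\<^sup>2 / 4) \<le> 1 / (6 * real N)"
  shows "equivalence_tester n \<epsilon> (gap_tester n N m \<theta> K)"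
  unfolding equivalence_tester_def
proof (intro allI impI conjI)
  fix P Q assume PQ: "dist_on n P" "dist_on n Q"
  define \<tau> where "\<tau> P Q = bind_pmf (pair_pmf (bernoulli_pmf (1 / 2)) (random_set n K)) (trial P Q n m \<theta>)" for P Q
  have "\<epsilon>\<^sup>2 * sqrt \<epsilon> \<le> 1 * 1" using \<epsilon> by (intro mult_mono) (auto simp: power_le_one)
  then have \<theta>: "0 < \<theta>" "\<theta> \<le> 1" unfolding \<theta>_def using \<epsilon> by simp_all
  have acc: "pmf (run (gap_tester n N m \<theta> K) P Q) Accept = (1 - pmf (\<tau> P Q) False) ^ N" for P Q
  proof -
    have "pmf (\<tau> P Q) True = 1 - pmf (\<tau> P Q) False" using pmf_bool_sum[of "\<tau> P Q"] by linarith
    then show ?thesis unfolding pmf_run_gap_tester_Accept \<tau>_def by simp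
  qed
  show "2 / 3 \<le> pmf (run (gap_tester n N m \<theta> K) P Q) Accept" if "P = Q"
  proof -
    have "pmf (\<tau> P P) False \<le> 2 * exp (- real m * \<theta>\<^sup>2 / 4)"
      unfolding \<tau>_def by (rule pmf_trial_False_equal[OF \<theta>])
    also have "\<dots> \<le> 1 / (3 * real N)" using m by simp
    finally have "real N * pmf (\<tau> P P) False \<le> 1 / 3" using N by (simp add: field_simps)
    then have "2 / 3 \<le> 1 + real N * (- pmf (\<tau> P P) False)" by simp
    also have "\<dots> \<le> (1 + - pmf (\<tau> P P) False) ^ N" by (intro Bernoulli_inequality) (simp add: pmf_le_1)
    finally show ?thesis unfolding acc using that by simp
  qed
  show "2 / 3 \<le> pmf (run (gap_tester n N m \<theta> K) P Q) Reject" if far: "\<epsilon> \<le> d_TV n P Q"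
  proof -
    obtain k where k: "\<forall>v\<in>{1..n}. k v \<in> {1..K}" and sum: "\<epsilon>\<^sup>2 * sqrt \<epsilon> / 2 ^ 14 \<le>
        (\<Sum>v\<in>{1..n}. (pmf P v + pmf Q v) *
          measure_pmf.expectation (random_subset n ((1 / 2) ^ k v)) (\<lambda>S. \<bar>gap P Q v S\<bar>))"
      using sum_expected_gap_lower_bound[OF PQ \<epsilon> far n K] by blast
    have "1 / (6 * real N) \<le> 1 / 2" using N by (simp add: field_simps)
    then have half: "exp (- real m * \<theta>\<^sup>2 / 4) \<le> 1 / 2" using m by linarith
    have "\<theta> / real K \<le> pmf (\<tau> P Q) False"
      unfolding \<tau>_def
    proof (rule pmf_trial_False_far[OF PQ \<theta> half])
      show "k v \<in> {1..K}" if "v \<in> {1..n}" for v using k that by blast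
      have "8 * \<theta> = \<epsilon>\<^sup>2 * sqrt \<epsilon> / 2 ^ 14" unfolding \<theta>_def by simp
      then show "8 * \<theta> \<le> (\<Sum>v\<in>{1..n}. (pmf P v + pmf Q v) *
          measure_pmf.expectation (random_subset n ((1 / 2) ^ k v)) (\<lambda>S. \<bar>gap P Q v S\<bar>))"
        using sum by linarith
    qed
    moreover have "0 < K" using k n by force
    ultimately have "2 \<le> real N * pmf (\<tau> P Q) False"
      using N(2) \<theta> mult_mono[of "2 * real K / \<theta>" "real N" "\<theta> / real K" "pmf (\<tau> P Q) False"] by simp
    have "(1 - pmf (\<tau> P Q) False) ^ N \<le> exp (- pmf (\<tau> P Q) False) ^ N"
      using exp_ge_add_one_self[of "- pmf (\<tau> P Q) False"] by (intro power_mono) (auto simp: pmf_le_1)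
    also have "\<dots> = exp (- (real N * pmf (\<tau> P Q) False))" by (simp flip: exp_of_nat_mult)
    also have "\<dots> \<le> exp (- 2)" using \<open>2 \<le> real N * pmf (\<tau> P Q) False\<close> by simp
    also have "\<dots> \<le> 1 / 3"
      using exp_ge_add_one_self[of 2] by (simp add: exp_minus field_simps)
    finally show ?thesis using acc[of P Q] pmf_verdict_sum[of "run (gap_tester n N m \<theta> K) P Q"] by simp
  qed
qed

section \<open>Parameters\<close>

definition threshold :: "real \<Rightarrow> real" where
  "threshold \<epsilon> = \<epsilon>\<^sup>2 * sqrt \<epsilon> / 2 ^ 17"

definition scales :: "nat \<Rightarrow> real \<Rightarrow> nat" where
  "scales n \<epsilon> = nat \<lceil>log 2 (128 * real n / \<epsilon>\<^sup>2)\<rceil>"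

definition repetitions :: "nat \<Rightarrow> real \<Rightarrow> nat" where
  "repetitions n \<epsilon> = nat \<lceil>2 * real (scales n \<epsilon>) / threshold \<epsilon>\<rceil>"

text \<open>The least natural number \<open>m\<close> for which the tail bound
  \<open>exp (- m * \<theta>\<^sup>2 / 4)\<close> is at most \<open>1 / (6 * N)\<close>.\<close>

definition samples :: "nat \<Rightarrow> real \<Rightarrow> nat" where
  "samples n \<epsilon> = nat \<lceil>4 / (threshold \<epsilon>)\<^sup>2 * ln (6 * real (repetitions n \<epsilon>))\<rceil>"

text \<open>Half-integer powers of \<open>\<epsilon>\<close> are rounded to integer ones. The cubic
  bound is used only inside a logarithm; the bound on the cube governs the query count.\<close>

lemma threshold_bounds:
  assumes "0 < \<epsilon>" "\<epsilon> \<le> 1"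
  shows "0 < threshold \<epsilon>" "threshold \<epsilon> \<le> 1" "\<epsilon> ^ 3 / 2 ^ 17 \<le> threshold \<epsilon>" "\<epsilon> ^ 8 / 2 ^ 51 \<le> threshold \<epsilon> ^ 3"
proof -
  show "0 < threshold \<epsilon>" unfolding threshold_def using assms by simp
  have "\<epsilon>\<^sup>2 * sqrt \<epsilon> \<le> 1 * 1" using assms by (intro mult_mono) (auto simp: power_le_one)
  then show "threshold \<epsilon> \<le> 1" unfolding threshold_def by simp
  have s: "\<epsilon> \<le> sqrt \<epsilon>"
    using assms by (intro real_le_rsqrt) (simp add: power2_eq_square mult_left_le)
  then have "\<epsilon>\<^sup>2 * \<epsilon> \<le> \<epsilon>\<^sup>2 * sqrt \<epsilon>" by (intro mult_left_mono) auto
  then show "\<epsilon> ^ 3 / 2 ^ 17 \<le> threshold \<epsilon>"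
    unfolding threshold_def by (simp add: power2_eq_square power3_eq_cube)
  have "threshold \<epsilon> ^ 3 = \<epsilon> ^ 6 * ((sqrt \<epsilon>)\<^sup>2 * sqrt \<epsilon>) / 2 ^ 51"
    unfolding threshold_def by (simp add: power_divide power_mult_distrib numeral_eq_Suc)
  also have "\<dots> = \<epsilon> ^ 7 * sqrt \<epsilon> / 2 ^ 51" using assms by (simp add: numeral_eq_Suc)
  finally have "threshold \<epsilon> ^ 3 = \<epsilon> ^ 7 * sqrt \<epsilon> / 2 ^ 51" .
  moreover have "\<epsilon> ^ 7 * \<epsilon> \<le> \<epsilon> ^ 7 * sqrt \<epsilon>" using s assms by (intro mult_left_mono) auto
  ultimately show "\<epsilon> ^ 8 / 2 ^ 51 \<le> threshold \<epsilon> ^ 3" by (simp add: numeral_eq_Suc mult.commute)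
qed

lemma parameters_adequate:
  assumes \<epsilon>: "0 < \<epsilon>" "\<epsilon> \<le> 1" and n: "1 \<le> n"
  shows "128 * real n / \<epsilon>\<^sup>2 \<le> 2 ^ scales n \<epsilon>" "1 \<le> scales n \<epsilon>"
    "1 \<le> repetitions n \<epsilon>" "2 * real (scales n \<epsilon>) / threshold \<epsilon> \<le> real (repetitions n \<epsilon>)"
    "exp (- real (samples n \<epsilon>) * (threshold \<epsilon>)\<^sup>2 / 4) \<le> 1 / (6 * real (repetitions n \<epsilon>))"
proof -
  have "128 * 1 * 1 \<le> 128 * real n * (1 / \<epsilon>\<^sup>2)" using n \<epsilon>
    by (intro mult_mono) (auto simp: field_simps power_le_one)
  then have x: "128 \<le> 128 * real n / \<epsilon>\<^sup>2" by simp
  have le: "log 2 (128 * real n / \<epsilon>\<^sup>2) \<le> real (scales n \<epsilon>)"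
    unfolding scales_def by (rule real_nat_ceiling_ge)
  have "128 * real n / \<epsilon>\<^sup>2 = 2 powr log 2 (128 * real n / \<epsilon>\<^sup>2)" using x by (simp add: powr_log_cancel)
  also have "\<dots> \<le> 2 powr real (scales n \<epsilon>)" using le by (intro powr_mono) auto
  finally show K: "128 * real n / \<epsilon>\<^sup>2 \<le> 2 ^ scales n \<epsilon>" by (simp add: powr_realpow)
  show K1: "1 \<le> scales n \<epsilon>"
  proof (rule ccontr)
    assume "\<not> 1 \<le> scales n \<epsilon>"
    then have "scales n \<epsilon> = 0" by simp
    then show False using K x by simp
  qed
  show N: "2 * real (scales n \<epsilon>) / threshold \<epsilon> \<le> real (repetitions n \<epsilon>)"
    unfolding repetitions_def by (rule real_nat_ceiling_ge)
  have "0 < 2 * real (scales n \<epsilon>) / threshold \<epsilon>" using K1 threshold_bounds[OF \<epsilon>] by simp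
  then show N1: "1 \<le> repetitions n \<epsilon>" using N by linarith
  have \<theta>: "0 < (threshold \<epsilon>)\<^sup>2" using threshold_bounds[OF \<epsilon>] by simp
  have "4 / (threshold \<epsilon>)\<^sup>2 * ln (6 * real (repetitions n \<epsilon>)) \<le> real (samples n \<epsilon>)"
    unfolding samples_def by (rule real_nat_ceiling_ge)
  then have "ln (6 * real (repetitions n \<epsilon>)) \<le> real (samples n \<epsilon>) * (threshold \<epsilon>)\<^sup>2 / 4"
    using \<theta> by (simp add: field_simps)
  then have "exp (- real (samples n \<epsilon>) * (threshold \<epsilon>)\<^sup>2 / 4) \<le> exp (- ln (6 * real (repetitions n \<epsilon>)))" by simp
  also have "\<dots> = 1 / (6 * real (repetitions n \<epsilon>))" using N1 by (simp add: exp_minus field_simps)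
  finally show "exp (- real (samples n \<epsilon>) * (threshold \<epsilon>)\<^sup>2 / 4) \<le> 1 / (6 * real (repetitions n \<epsilon>))" .
qed

text \<open>Rejecting already at a smaller distance is a stronger guarantee, so parameters for
  \<open>\<epsilon> \<le> 1\<close> cover all positive \<open>\<epsilon>\<close>.\<close>

lemma equivalence_tester_min:
  assumes "equivalence_tester n (min \<epsilon> 1) T"
  shows "equivalence_tester n \<epsilon> T"
  using assms unfolding equivalence_tester_def by (simp add: min_le_iff_disj)

text \<open>The product of repetitions and samples is of order
  \<open>K * ln N / \<theta> ^ 3\<close>. Here \<open>K\<close> is of order \<open>a * c\<close> and
  \<open>ln N\<close> of order \<open>b * c\<close>. For \<open>n \<ge> 3\<close> and
  \<open>\<epsilon> \<le> 1/2\<close> the three logarithms are bounded away from 0, so sums of them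
  can be absorbed into products.\<close>

lemma query_complexity_bound:
  assumes n: "3 \<le> n" and \<epsilon>: "0 < \<epsilon>" "\<epsilon> \<le> 1 / 2"
  shows "real (query_complexity (repetitions n \<epsilon>) (repetitions n \<epsilon> * samples n \<epsilon>))
    \<le> 1440 * 2 ^ 51 * (2 + 61 / ln (ln 3)) * (ln (real n) * ln (ln (real n)) * ln (1 / \<epsilon>) / \<epsilon> ^ 9)"
proof -
  define a b c \<kappa> where "a = ln (real n)" and "b = ln (ln (real n))" and "c = ln (1 / \<epsilon>)" and "\<kappa> = ln (ln (3::real))"
  define \<theta> K N m where "\<theta> = threshold \<epsilon>" and "K = real (scales n \<epsilon>)" and "N = real (repetitions n \<epsilon>)"
    and "m = real (samples n \<epsilon>)"
  have \<epsilon>1: "\<epsilon> \<le> 1" and n1: "1 \<le> n" using \<epsilon> n by auto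
  have \<theta>: "0 < \<theta>" "\<theta> \<le> 1" "\<epsilon> ^ 3 / 2 ^ 17 \<le> \<theta>" "\<epsilon> ^ 8 / 2 ^ 51 \<le> \<theta> ^ 3"
    unfolding \<theta>_def by (rule threshold_bounds[OF \<epsilon>(1) \<epsilon>1])+
  have K1: "1 \<le> K" and N1: "1 \<le> N" unfolding K_def N_def using parameters_adequate[OF \<epsilon>(1) \<epsilon>1 n1] by simp_all
  have ln3: "1 < ln (3::real)" using ln_less_cancel_iff[of "exp 1" 3] e_less_272 by simp
  have a: "ln 3 \<le> a" unfolding a_def using n by simp
  have \<kappa>: "0 < \<kappa>" "\<kappa> \<le> b" unfolding \<kappa>_def b_def using ln3 a unfolding a_def by simp_all
  have ln2: "1 / 2 \<le> ln (2::real)" "ln (2::real) \<le> 1" using ln_2_less_1 ln2_ge_two_thirds by simp_all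
  have "ln 2 \<le> c" unfolding c_def using \<epsilon> by (simp add: field_simps)
  then have c: "1 / 2 \<le> c" using ln2 by linarith
  have a1: "1 \<le> a" using a ln3 by simp
  have ac: "1 / 2 \<le> a * c" "a \<le> 2 * (a * c)" "c \<le> a * c"
    using mult_mono[of 1 a "1 / 2" c] mult_left_mono[of "1 / 2" c a] mult_right_mono[of 1 a c] a1 c by simp_all

  have "K \<le> log 2 (128 * real n / \<epsilon>\<^sup>2) + 1"
  proof -
    have "0 \<le> log 2 (128 * real n / \<epsilon>\<^sup>2)"
    proof -
      have "128 * 1 * 1 \<le> 128 * real n * (1 / \<epsilon>\<^sup>2)" using n1 \<epsilon> \<epsilon>1
        by (intro mult_mono) (auto simp: field_simps power_le_one)
      then show ?thesis by simp
    qed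
    then show ?thesis unfolding K_def scales_def by linarith
  qed
  also have "log 2 (128 * real n / \<epsilon>\<^sup>2) = (ln (2 ^ 7) + a + 2 * c) / ln 2"
    unfolding log_def a_def c_def using n \<epsilon> by (simp add: ln_mult ln_div ln_realpow)
  also have "\<dots> = 7 + (a + 2 * c) / ln 2" using ln2 by (subst ln_realpow) (simp_all add: add_divide_distrib)
  also have "(a + 2 * c) / ln 2 \<le> (a + 2 * c) / (1 / 2)"
    using a1 c ln2 by (intro divide_left_mono) auto
  \<comment> \<open>The bound so far is \<open>8 + 2 * a + 4 * c\<close>; its terms cost at most 16,
    4 and 4 times \<open>a * c\<close>.\<close>
  finally have K: "K \<le> 24 * (a * c)" using ac by simp

  have "N \<le> 2 * K / \<theta> + 1"
    unfolding N_def repetitions_def K_def[symmetric] \<theta>_def[symmetric] using K1 \<theta> by (simp add: of_nat_nat)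
  also have "1 \<le> K / \<theta>" using K1 \<theta> by (simp add: field_simps)
  finally have "N \<le> 3 * K / \<theta>" by simp
  also have "\<dots> \<le> 72 * (a * c) / \<theta>" using K \<theta> by (intro divide_right_mono) auto
  finally have N: "N \<le> 72 * (a * c) / \<theta>" .

  have "ln (6 * N) \<le> ln (2 ^ 9 * a * c * (2 ^ 17 / \<epsilon> ^ 3))"
  proof -
    have "6 * N \<le> 432 * (a * c) * (1 / \<theta>)" using N by simp
    also have "\<dots> \<le> 2 ^ 9 * (a * c) * (2 ^ 17 / \<epsilon> ^ 3)"
      using \<theta> \<epsilon> ac a1 c by (intro mult_mono) (auto simp: field_simps)
    finally show ?thesis using N1 by (simp add: mult.assoc)
  qed
  also have "\<dots> = 9 * ln 2 + b + ln c + 17 * ln 2 + 3 * c"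
  proof -
    have "b = ln a" "ln \<epsilon> = - c" unfolding a_def b_def c_def using \<epsilon> by (simp_all add: ln_div)
    moreover have "ln (2 ^ 9 * a * c * (2 ^ 17 / \<epsilon> ^ 3)) = ln (2 ^ 9) + ln a + ln c + (ln (2 ^ 17) - ln (\<epsilon> ^ 3))"
      using a1 c \<epsilon> by (simp only: ln_mult_pos ln_divide_pos mult_pos_pos divide_pos_pos zero_less_power
          zero_less_numeral order.strict_trans2[OF zero_less_one] order.strict_trans2[OF half_gt_zero[OF zero_less_one]])
    moreover have "ln (2 ^ 9 :: real) = 9 * ln 2" "ln (2 ^ 17 :: real) = 17 * ln 2" "ln (\<epsilon> ^ 3) = 3 * ln \<epsilon>"
      using \<epsilon> by (subst ln_realpow; simp)+
    ultimately show ?thesis by linarith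
  qed
  also have "\<dots> \<le> 26 + b + 4 * c" using ln2 ln_le_minus_one[of c] c by simp
  \<comment> \<open>Since \<open>c \<ge> 1/2\<close>, the terms \<open>26 + 4 * c\<close> are at
    most \<open>56 * c\<close>, hence at most \<open>61 * b * c / \<kappa>\<close>, and
    \<open>b \<le> 2 * b * c\<close>.\<close>
  also have "\<dots> \<le> (2 + 61 / \<kappa>) * (b * c)"
  proof -
    have "\<kappa> * c \<le> b * c" "b * (1 / 2) \<le> b * c" using \<kappa> c by (intro mult_right_mono mult_left_mono; simp)+
    then have "c \<le> b * c / \<kappa>" "b \<le> 2 * (b * c)" using \<kappa> by (simp_all add: field_simps)
    moreover have "(2 + 61 / \<kappa>) * (b * c) = 2 * (b * c) + 61 * (b * c / \<kappa>)" by (simp add: algebra_simps)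
    ultimately show ?thesis using c by simp
  qed
  finally have lnN: "ln (6 * N) \<le> (2 + 61 / \<kappa>) * (b * c)" .

  have lnN1: "1 \<le> ln (6 * N)"
  proof -
    have "ln 3 \<le> ln (6 * N)" using N1 by simp
    then show ?thesis using ln3 by linarith
  qed
  have "1 \<le> 1 / \<theta>\<^sup>2" using \<theta> by (simp add: power_le_one)
  then have \<theta>lnN: "1 \<le> 1 / \<theta>\<^sup>2 * ln (6 * N)" using lnN1 mult_mono[of 1 "1 / \<theta>\<^sup>2" 1 "ln (6 * N)"] by simp
  have m: "m \<le> 4 / \<theta>\<^sup>2 * ln (6 * N) + 1" and m1: "1 \<le> m"
  proof -
    have m_eq: "m = real (nat \<lceil>4 / \<theta>\<^sup>2 * ln (6 * N)\<rceil>)" unfolding m_def samples_def \<theta>_def N_def ..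
    have pos: "1 \<le> 4 / \<theta>\<^sup>2 * ln (6 * N)" using \<theta>lnN by simp
    then show "m \<le> 4 / \<theta>\<^sup>2 * ln (6 * N) + 1" unfolding m_eq by linarith
    show "1 \<le> m" using pos real_nat_ceiling_ge[of "4 / \<theta>\<^sup>2 * ln (6 * N)"] unfolding m_eq by linarith
  qed
  have "m \<le> 5 / \<theta>\<^sup>2 * ln (6 * N)" using m \<theta>lnN by simp
  also have "\<dots> \<le> 5 / \<theta>\<^sup>2 * ((2 + 61 / \<kappa>) * (b * c))" by (intro mult_left_mono lnN) simp
  finally have m2: "m \<le> 5 / \<theta>\<^sup>2 * ((2 + 61 / \<kappa>) * (b * c))" .

  define D where "D = 2 + 61 / \<kappa>"
  have D0: "0 \<le> D" unfolding D_def using \<kappa> by simp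
  have "real (query_complexity (repetitions n \<epsilon>) (repetitions n \<epsilon> * samples n \<epsilon>)) = 2 * (N * 1 + N * m)"
    unfolding query_complexity_def N_def m_def by simp
  also have "\<dots> \<le> 2 * (N * m + N * m)"
    using N1 m1 by (intro mult_left_mono add_right_mono) auto
  also have "\<dots> = 4 * (N * m)" by simp
  also have "\<dots> \<le> 4 * (72 * (a * c) / \<theta> * (5 / \<theta>\<^sup>2 * (D * (b * c))))"
    using N m2 N1 m1 ac \<theta> unfolding D_def by (intro mult_left_mono mult_mono) auto
  also have "\<dots> = 1440 * D * (a * b * c) * c * (1 / \<theta> ^ 3)"
    by (simp add: power2_eq_square power3_eq_cube mult_ac)
  \<comment> \<open>Two factors \<open>c\<close> have accumulated, one from the scales and one from
    \<open>ln N\<close>. One of them is traded for \<open>1 / \<epsilon>\<close>, which raises the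
    exponent from 8 to 9.\<close>
  also have "\<dots> \<le> 1440 * D * (a * b * c) * (1 / \<epsilon>) * (2 ^ 51 / \<epsilon> ^ 8)"
  proof (intro mult_mono)
    show "c \<le> 1 / \<epsilon>" unfolding c_def by (rule less_imp_le, rule ln_less_self) (use \<epsilon> in simp)
    show "1 / \<theta> ^ 3 \<le> 2 ^ 51 / \<epsilon> ^ 8" using \<theta> \<epsilon> by (simp add: field_simps)
  qed (use D0 a1 \<kappa> c \<epsilon> \<theta> in auto)
  also have "\<dots> = 1440 * 2 ^ 51 * D * (a * b * c / \<epsilon> ^ 9)"
    by (simp add: numeral_eq_Suc)
  finally show ?thesis unfolding D_def a_def b_def c_def \<kappa>_def .
qed

theorem theorem1:
  "\<exists>(T :: nat \<Rightarrow> real \<Rightarrow> tester) (q1 :: nat \<Rightarrow> real \<Rightarrow> nat) (q2 :: nat \<Rightarrow> real \<Rightarrow> nat) (C :: real).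
     (\<forall>n \<epsilon>. 1 \<le> n \<longrightarrow> 0 < \<epsilon> \<longrightarrow>
        one_round_adaptive n (q1 n \<epsilon>) (q2 n \<epsilon>) (T n \<epsilon>) \<and> equivalence_tester n \<epsilon> (T n \<epsilon>)) \<and>
     (\<forall>n \<epsilon>. 3 \<le> n \<longrightarrow> 0 < \<epsilon> \<longrightarrow> \<epsilon> \<le> 1 / 2 \<longrightarrow>
        real (query_complexity (q1 n \<epsilon>) (q2 n \<epsilon>)) \<le>
          C * (ln (real n) * ln (ln (real n)) * ln (1 / \<epsilon>) / \<epsilon> ^ 9))"
proof -
  define q1 where "q1 n \<epsilon> = repetitions n (min \<epsilon> 1)" for n \<epsilon>
  define q2 where "q2 n \<epsilon> = repetitions n (min \<epsilon> 1) * samples n (min \<epsilon> 1)" for n \<epsilon>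
  define T where "T n \<epsilon> = gap_tester n (repetitions n (min \<epsilon> 1)) (samples n (min \<epsilon> 1))
      (threshold (min \<epsilon> 1)) (scales n (min \<epsilon> 1))" for n \<epsilon>
  have "one_round_adaptive n (q1 n \<epsilon>) (q2 n \<epsilon>) (T n \<epsilon>) \<and> equivalence_tester n \<epsilon> (T n \<epsilon>)"
    if n: "1 \<le> n" and "0 < \<epsilon>" for n \<epsilon>
  proof
    have \<epsilon>: "0 < min \<epsilon> 1" "min \<epsilon> 1 \<le> 1" using \<open>0 < \<epsilon>\<close> by auto
    note p = parameters_adequate[OF \<epsilon> n]
    show "one_round_adaptive n (q1 n \<epsilon>) (q2 n \<epsilon>) (T n \<epsilon>)"
      unfolding q1_def q2_def T_def by (rule one_round_adaptive_gap_tester[OF n p(2)])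
    show "equivalence_tester n \<epsilon> (T n \<epsilon>)"
      unfolding T_def threshold_def
      by (rule equivalence_tester_min)
        (rule equivalence_tester_gap_tester[OF \<epsilon> n p(1) p(3) p(4)[unfolded threshold_def] p(5)[unfolded threshold_def]])
  qed
  \<comment> \<open>In this range of \<open>\<epsilon>\<close> the cap at 1 is inactive.\<close>
  moreover have "real (query_complexity (q1 n \<epsilon>) (q2 n \<epsilon>))
      \<le> 1440 * 2 ^ 51 * (2 + 61 / ln (ln 3)) * (ln (real n) * ln (ln (real n)) * ln (1 / \<epsilon>) / \<epsilon> ^ 9)"
    if "3 \<le> n" "0 < \<epsilon>" "\<epsilon> \<le> 1 / 2" for n \<epsilon>
    using query_complexity_bound[OF that] that unfolding q1_def q2_def by (simp add: min_def)
  ultimately show ?thesis by blast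
qed

end
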